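(* For every positive integer $n$, the mixed cycle $C^{2}_{2n+1}$ is determined by its Hermitian spectrum (DHS).
   Context: A mixed graph has undirected edges and directed edges (ordered pairs $(x,y)$). For vertices $v_1,\dots,v_n$, its Hermitian adjacency matrix $H(X)$ has $(j,k)$ entry $1$ if $v_jv_k$ is an undirected edge, $i$ if $(v_j,v_k)$ is a directed edge, $-i$ if $(v_k,v_j)$ is a directed edge, $0$ otherwise; $\mathrm{Spec}_H(X)$ is its multiset of eigenvalues. Mixed graphs $X,Y$ on the same vertex set are switching equivalent if $H(X)=D^{-1}H(Y)D$ for a diagonal $D$ with diagonal entries in $\{\pm1,\pm i\}$. A mixed graph $X$ is DHS if every mixed graph $Y$ with $\mathrm{Spec}_H(Y)=\mathrm{Spec}_H(X)$ is switching equivalent to a mixed graph isomorphic to $X$. $C^2_m$ is the mixed cycle of order $m$ with two consecutive directed edges $(u,v),(v,w)$ with the same direction and all other edges undirected. *)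

theory Defs
  imports
    "Jordan_Normal_Form.Char_Poly"
    "HOL-Computational_Algebra.Computational_Algebra"
begin

record 'a mixed_graph =
  verts :: "'a set"
  edges :: "'a set set"
  arcs  :: "('a \<times> 'a) set"

text \<open>
  The underlying graph is finite and simple: no loops, and at most one undirected edge or arc
  between two vertices.
\<close>

definition mixed_graph :: "'a mixed_graph \<Rightarrow> bool" where
  "mixed_graph X \<longleftrightarrow>
     finite (verts X) \<and>
     edges X \<subseteq> {{u, v} |u v. u \<in> verts X \<and> v \<in> verts X \<and> u \<noteq> v} \<and>
     arcs X \<subseteq> {(u, v). u \<in> verts X \<and> v \<in> verts X \<and> u \<noteq> v} \<and>
     (\<forall>(u, v) \<in> arcs X. (v, u) \<notin> arcs X \<and> {u, v} \<notin> edges X)"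

definition isomorphic :: "'a mixed_graph \<Rightarrow> 'b mixed_graph \<Rightarrow> bool" where
  "isomorphic X Y \<longleftrightarrow>
     (\<exists>f. bij_betw f (verts X) (verts Y) \<and>
          (\<forall>u \<in> verts X. \<forall>v \<in> verts X.
             ({u, v} \<in> edges X \<longleftrightarrow> {f u, f v} \<in> edges Y) \<and>
             ((u, v) \<in> arcs X \<longleftrightarrow> (f u, f v) \<in> arcs Y)))"

definition hentry :: "'a mixed_graph \<Rightarrow> 'a \<Rightarrow> 'a \<Rightarrow> complex" where
  "hentry X u v =
     (if {u, v} \<in> edges X then 1
      else if (u, v) \<in> arcs X then \<i>
      else if (v, u) \<in> arcs X then - \<i>
      else 0)"

text \<open>The Hermitian adjacency matrix for the enumeration \<open>vs\<close> of the vertices.\<close>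

definition hmat :: "'a mixed_graph \<Rightarrow> 'a list \<Rightarrow> complex mat" where
  "hmat X vs = mat (length vs) (length vs) (\<lambda>(j, k). hentry X (vs ! j) (vs ! k))"

text \<open>
  An arbitrary enumeration, fixed once and for all for each finite set. The notions below do not
  depend on this choice; see \<open>spec_H_eq\<close> and \<open>switching_equivalent_iff\<close>.
\<close>

definition enum_of :: "'a set \<Rightarrow> 'a list" where
  "enum_of V = (SOME vs. distinct vs \<and> set vs = V)"

abbreviation hermitian_adj :: "'a mixed_graph \<Rightarrow> complex mat" where
  "hermitian_adj X \<equiv> hmat X (enum_of (verts X))"

definition spec_H :: "'a mixed_graph \<Rightarrow> complex multiset" where
  "spec_H X = proots (char_poly (hermitian_adj X))"

definition switching_equivalent :: "'a mixed_graph \<Rightarrow> 'a mixed_graph \<Rightarrow> bool" where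
  "switching_equivalent X Y \<longleftrightarrow>
     verts X = verts Y \<and>
     (\<exists>D D' :: complex mat.
        D \<in> carrier_mat (card (verts X)) (card (verts X)) \<and>
        D' \<in> carrier_mat (card (verts X)) (card (verts X)) \<and>
        diagonal_mat D \<and>
        (\<forall>j < card (verts X). D $$ (j, j) \<in> {1, -1, \<i>, -\<i>}) \<and>
        inverts_mat D' D \<and> inverts_mat D D' \<and>
        hermitian_adj X = D' * hermitian_adj Y * D)"

text \<open>
  The type argument is the type of the vertices of the competing graphs \<open>Y\<close>.
\<close>

definition DHS :: "'b itself \<Rightarrow> 'a mixed_graph \<Rightarrow> bool" where
  "DHS TYPE('b) X \<longleftrightarrow>
     (\<forall>Y :: 'b mixed_graph.
        mixed_graph Y \<and> spec_H Y = spec_H X \<longrightarrow>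
        (\<exists>Z :: 'b mixed_graph.
           mixed_graph Z \<and> isomorphic Z X \<and> switching_equivalent Y Z))"

text \<open>The mixed cycle \<open>C\<^sup>2\<^sub>m\<close>, for \<open>m \<ge> 3\<close>, with arcs \<open>0 \<rightarrow> 1 \<rightarrow> 2\<close>.\<close>

definition mixed_cycle2 :: "nat \<Rightarrow> nat mixed_graph" where
  "mixed_cycle2 m =
     \<lparr>verts = {0..<m},
      edges = {{k, (k + 1) mod m} |k. 2 \<le> k \<and> k < m},
      arcs = {(0, 1), (1, 2)}\<rparr>"

lemma enum_of:
  assumes "finite V"
  shows "distinct (enum_of V)" "set (enum_of V) = V" "length (enum_of V) = card V"
proof -
  have "\<exists>vs. distinct vs \<and> set vs = V"
    using finite_distinct_list[OF assms] by blast
  then have *: "distinct (enum_of V) \<and> set (enum_of V) = V"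
    unfolding enum_of_def by (rule someI_ex)
  then show "distinct (enum_of V)" "set (enum_of V) = V" by auto
  then show "length (enum_of V) = card V"
    using distinct_card by fastforce
qed

lemma hmat_dim [simp]: "hmat X vs \<in> carrier_mat (length vs) (length vs)"
  by (simp add: hmat_def)

lemma hmat_similar:
  assumes "distinct vs" "distinct ws" "set vs = set ws"
  shows "similar_mat (hmat X vs) (hmat X ws)"
proof -
  define n where "n = length vs"
  have n2: "length ws = n"
    using assms unfolding n_def by (metis distinct_card)
  define P where "P = mat n n (\<lambda>(i, j). if vs ! i = ws ! j then 1 else (0::complex))"
  define Q where "Q = mat n n (\<lambda>(i, j). if ws ! i = vs ! j then 1 else (0::complex))"
  have ex: "\<exists>k<n. ws ! k = vs ! i" if "i < n" for i
    using that assms n2 n_def by (metis in_set_conv_nth)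
  have ex': "\<exists>k<n. vs ! k = ws ! i" if "i < n" for i
    using that assms n2 n_def by (metis in_set_conv_nth)
  have inj: "ws ! i = ws ! j \<longleftrightarrow> i = j" if "i < n" "j < n" for i j
    using that assms n2 nth_eq_iff_index_eq by metis
  have inj': "vs ! i = vs ! j \<longleftrightarrow> i = j" if "i < n" "j < n" for i j
    using that assms n_def nth_eq_iff_index_eq by metis
  have pick: "(\<Sum>k = 0..<n. (if R k then 1 else 0) * (f k :: complex)) = f k0"
    if "k0 < n" "\<And>k. k < n \<Longrightarrow> R k \<longleftrightarrow> k = k0" for R f k0
  proof -
    have "(\<Sum>k = 0..<n. (if R k then 1 else 0) * f k) = (\<Sum>k = 0..<n. if k = k0 then f k else 0)"
      using that by (intro sum.cong) auto
    then show ?thesis using that by simp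
  qed
  have PQ: "P * Q = 1\<^sub>m n"
  proof (rule eq_matI)
    fix i j assume ij: "i < dim_row (1\<^sub>m n)" "j < dim_col (1\<^sub>m n)"
    then obtain k where k: "k < n" "ws ! k = vs ! i" using ex[of i] by auto
    have "(P * Q) $$ (i, j) = (\<Sum>l = 0..<n. (if vs ! i = ws ! l then 1 else 0) * (if ws ! l = vs ! j then 1 else 0))"
      using ij by (simp add: P_def Q_def scalar_prod_def)
    also have "\<dots> = (if ws ! k = vs ! j then 1 else 0)"
      using k inj by (intro pick) (auto simp flip: k(2))
    finally show "(P * Q) $$ (i, j) = (1\<^sub>m n) $$ (i, j)" using ij k inj' by simp
  qed (auto simp: P_def Q_def)
  have QP: "Q * P = 1\<^sub>m n"
    by (rule mat_mult_left_right_inverse[OF _ _ PQ]) (auto simp: P_def Q_def)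
  have comm: "hmat X vs * P = P * hmat X ws"
  proof (rule eq_matI)
    fix i j assume "i < dim_row (P * hmat X ws)" "j < dim_col (P * hmat X ws)"
    then have ij: "i < n" "j < n" using n2 by (auto simp: P_def hmat_def)
    obtain k where k: "k < n" "ws ! k = vs ! i" using ex ij by blast
    obtain l where l: "l < n" "vs ! l = ws ! j" using ex' ij by blast
    have "(hmat X vs * P) $$ (i, j)
        = (\<Sum>m = 0..<n. (if vs ! m = ws ! j then 1 else 0) * hentry X (vs ! i) (vs ! m))"
      using ij by (simp add: P_def hmat_def scalar_prod_def n_def[symmetric] mult.commute)
    also have "\<dots> = hentry X (vs ! i) (vs ! l)"
      using l inj' by (intro pick) (auto simp flip: l(2))
    also have "\<dots> = hentry X (ws ! k) (ws ! j)" using k l by simp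
    also have "\<dots> = (\<Sum>m = 0..<n. (if vs ! i = ws ! m then 1 else 0) * hentry X (ws ! m) (ws ! j))"
      using k inj by (intro pick[symmetric]) (auto simp flip: k(2))
    also have "\<dots> = (P * hmat X ws) $$ (i, j)"
      using ij by (simp add: P_def hmat_def scalar_prod_def n2)
    finally show "(hmat X vs * P) $$ (i, j) = (P * hmat X ws) $$ (i, j)" .
  qed (auto simp: P_def hmat_def n_def n2)
  have c: "hmat X vs \<in> carrier_mat n n" "hmat X ws \<in> carrier_mat n n"
    "P \<in> carrier_mat n n" "Q \<in> carrier_mat n n"
    by (auto simp: hmat_def n_def n2 P_def Q_def)
  have "hmat X vs = hmat X vs * (P * Q)"
    unfolding PQ by (rule right_mult_one_mat[OF c(1), symmetric])
  also have "\<dots> = hmat X vs * P * Q"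
    by (rule assoc_mult_mat[OF c(1,3,4), symmetric])
  finally have "hmat X vs = P * hmat X ws * Q" unfolding comm .
  then have "similar_mat_wit (hmat X vs) (hmat X ws) P Q"
    using c PQ QP by (auto simp: similar_mat_wit_def Let_def)
  then show ?thesis unfolding similar_mat_def by blast
qed

lemma spec_H_eq:
  assumes "distinct vs" "set vs = verts X"
  shows "spec_H X = proots (char_poly (hmat X vs))"
proof -
  have "finite (verts X)" using assms by (metis List.finite_set)
  then show ?thesis
    using assms hmat_similar[of "enum_of (verts X)" vs X] enum_of[of "verts X"]
    by (simp add: spec_H_def char_poly_similar)
qed

lemma switching_equivalent_iff:
  assumes fin: "finite (verts X)"
  shows "switching_equivalent X Y \<longleftrightarrow>
     verts X = verts Y \<and>
     (\<exists>d. (\<forall>v \<in> verts X. d v \<in> {1, -1, \<i>, -\<i>}) \<and>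
          (\<forall>u \<in> verts X. \<forall>v \<in> verts X. hentry X u v = inverse (d u) * hentry Y u v * d v))"
    (is "?L \<longleftrightarrow> ?R")
proof -
  define n where "n = card (verts X)"
  define vs where "vs = enum_of (verts X)"
  have vs: "distinct vs" "set vs = verts X" "length vs = n"
    using enum_of[OF fin] by (auto simp: vs_def n_def)
  have vin: "vs ! i \<in> verts X" if "i < n" for i
    using that vs nth_mem by metis
  define U :: "complex set" where "U = {1, -1, \<i>, -\<i>}"
  have U0: "z \<noteq> 0" if "z \<in> U" for z using that by (auto simp: U_def)
  have prod: "mat_diag n (\<lambda>i. inverse (d i)) * hmat Y vs * mat_diag n d
      = mat n n (\<lambda>(i, j). inverse (d i) * hentry Y (vs ! i) (vs ! j) * d j)" for d
  proof -
    have "mat_diag n (\<lambda>i. inverse (d i)) * hmat Y vs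
        = mat n n (\<lambda>(i, j). inverse (d i) * hentry Y (vs ! i) (vs ! j))"
      by (subst mat_diag_mult_left[of _ n n]) (auto simp: hmat_def vs)
    then show ?thesis
      by (simp add: mat_diag_mult_right[of _ n n]) (rule eq_matI, auto)
  qed
  show ?thesis
  proof
    assume L: ?L
    then obtain D D' :: "complex mat" where D: "D \<in> carrier_mat n n" "D' \<in> carrier_mat n n"
      "diagonal_mat D" "\<forall>j<n. D $$ (j, j) \<in> U" "inverts_mat D' D"
      "inverts_mat D D'" "hmat X vs = D' * hmat Y vs * D" and XY: "verts X = verts Y"
      by (auto simp: switching_equivalent_def vs_def n_def U_def)
    define d where "d = (\<lambda>j. D $$ (j, j))"
    have dU: "d j \<in> U" if "j < n" for j using D(4) that by (simp add: d_def)
    have Deq: "D = mat_diag n d"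
      using D(1,3) by (intro eq_matI) (auto simp: mat_diag_def d_def diagonal_mat_def)
    have inv: "D * mat_diag n (\<lambda>i. inverse (d i)) = 1\<^sub>m n"
      unfolding Deq mat_diag_diag using dU U0 by (auto simp: mat_diag_def intro!: eq_matI)
    have "D' = D' * (D * mat_diag n (\<lambda>i. inverse (d i)))"
      using inv D(2) by simp
    also have "\<dots> = (D' * D) * mat_diag n (\<lambda>i. inverse (d i))"
      using D(1,2) by (metis assoc_mult_mat mat_diag_dim)
    also have "\<dots> = mat_diag n (\<lambda>i. inverse (d i))"
      using D(2,5) left_mult_one_mat[OF mat_diag_dim] by (auto simp: inverts_mat_def)
    finally have D'eq: "D' = mat_diag n (\<lambda>i. inverse (d i))" .
    have eq: "hmat X vs = mat n n (\<lambda>(i, j). inverse (d i) * hentry Y (vs ! i) (vs ! j) * d j)"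
      using D(7) prod[of d] by (simp add: Deq D'eq)
    have ent: "hentry X (vs ! i) (vs ! j) = inverse (d i) * hentry Y (vs ! i) (vs ! j) * d j"
      if "i < n" "j < n" for i j
      using arg_cong[OF eq, of "\<lambda>M. M $$ (i, j)"] that by (simp add: hmat_def vs)
    define idx where "idx = (\<lambda>v. THE i. i < n \<and> vs ! i = v)"
    have idx: "idx v < n \<and> vs ! idx v = v" if "v \<in> verts X" for v
    proof -
      have "\<exists>!i. i < n \<and> vs ! i = v"
        using that vs by (metis in_set_conv_nth nth_eq_iff_index_eq)
      then show ?thesis unfolding idx_def by (rule theI')
    qed
    have "d (idx v) \<in> {1, -1, \<i>, -\<i>}" if "v \<in> verts X" for v
      using dU idx[OF that] by (simp add: U_def)
    moreover have "hentry X u v = inverse (d (idx u)) * hentry Y u v * d (idx v)"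
      if "u \<in> verts X" "v \<in> verts X" for u v
      using ent[of "idx u" "idx v"] idx[OF that(1)] idx[OF that(2)] by simp
    ultimately show ?R using XY by (intro conjI exI[of _ "\<lambda>v. d (idx v)"]) blast+
  next
    assume ?R
    then obtain d where XY: "verts X = verts Y" and d: "\<forall>v \<in> verts X. d v \<in> U"
      and e: "\<forall>u \<in> verts X. \<forall>v \<in> verts X. hentry X u v = inverse (d u) * hentry Y u v * d v"
      by (auto simp: U_def)
    define D where "D = mat_diag n (\<lambda>i. d (vs ! i))"
    define D' where "D' = mat_diag n (\<lambda>i. inverse (d (vs ! i)))"
    have nz: "d (vs ! i) \<noteq> 0" if "i < n" for i using d vin[OF that] U0 by blast
    have "D * D' = 1\<^sub>m n" "D' * D = 1\<^sub>m n"
      unfolding D_def D'_def mat_diag_diag using nz by (auto simp: mat_diag_def intro!: eq_matI)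
    moreover have "hmat X vs = D' * hmat Y vs * D"
      unfolding D_def D'_def prod using e vin by (auto simp: hmat_def vs intro!: eq_matI)
    moreover have "D \<in> carrier_mat n n" "D' \<in> carrier_mat n n" "diagonal_mat D"
      "\<forall>j<n. D $$ (j, j) \<in> U"
      using d vin by (auto simp: D_def D'_def diagonal_mat_def mat_diag_def)
    ultimately show ?L
      unfolding switching_equivalent_def n_def[symmetric] vs_def[symmetric] U_def[symmetric]
        XY[symmetric]
      using XY by (intro conjI exI[of _ D] exI[of _ D']) (auto simp: inverts_mat_def)
  qed
qed

lemma mixed_graph_mixed_cycle2:
  assumes "m \<ge> 3"
  shows "mixed_graph (mixed_cycle2 m)"
proof -
  have step: "(k + 1) mod m < m \<and> (k + 1) mod m \<noteq> k \<and> (k + 1) mod m \<noteq> 1 \<and> (k + 1) mod m \<noteq> 2"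
    if "2 \<le> k" "k < m" for k
  proof (cases "k + 1 = m")
    case False
    then have "(k + 1) mod m = k + 1" using that by simp
    then show ?thesis using that False by linarith
  qed (use that in auto)
  have "edges (mixed_cycle2 m) \<subseteq> {{u, v} |u v. u \<in> {0..<m} \<and> v \<in> {0..<m} \<and> u \<noteq> v}"
  proof
    fix e assume "e \<in> edges (mixed_cycle2 m)"
    then obtain k where "2 \<le> k" "k < m" "e = {k, (k + 1) mod m}"
      by (auto simp: mixed_cycle2_def)
    then show "e \<in> {{u, v} |u v. u \<in> {0..<m} \<and> v \<in> {0..<m} \<and> u \<noteq> v}"
      using step[of k] by fastforce
  qed
  moreover have no1: "1 \<notin> e" if "e \<in> edges (mixed_cycle2 m)" for e
    using that step by (fastforce simp: mixed_cycle2_def)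
  have "{0, 1} \<notin> edges (mixed_cycle2 m)" "{1, 2} \<notin> edges (mixed_cycle2 m)"
    using no1 by blast+
  moreover have "verts (mixed_cycle2 m) = {0..<m}" "arcs (mixed_cycle2 m) = {(0, 1), (1, 2)}"
    by (simp_all add: mixed_cycle2_def)
  ultimately show ?thesis
    unfolding mixed_graph_def using assms by auto
qed

end

theory Submission
  imports Defs "Jordan_Normal_Form.Schur_Decomposition"
begin

text \<open>
  Write \<open>m = 2 n + 1\<close> and let \<open>L\<^sub>k(H)\<close> be given by \<open>L\<^sub>0 = 2\<close>, \<open>L\<^sub>1 = H\<close>,
  \<open>L\<^sub>k\<^sub>+\<^sub>2 = H L\<^sub>k\<^sub>+\<^sub>1 - L\<^sub>k\<close>; so \<open>L\<^sub>k\<close> sends \<open>z + 1/z\<close> to \<open>z^k + 1/z^k\<close>. Cospectral graphs have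
  the same traces of \<open>L\<^sub>k(H)\<close> and of \<open>L\<^sub>k(H)\<^sup>2\<close>, and for \<open>C\<^sup>2\<^sub>m\<close>, which switches to the cycle with all
  entries \<open>-1\<close>, these are explicit.

  Let \<open>H\<close> be the matrix of a cospectral graph. The traces for \<open>k = m\<close> give \<open>L\<^sub>m(H) = -2 I\<close>. As \<open>L\<^sub>m\<close>
  is odd, no nonzero diagonal matrix anticommutes with \<open>H\<close>, so the transposed unsigned incidence
  matrix is injective; it is square since there are \<open>m\<close> edges, so the incidence matrix is injective
  and the graph has no 4-cycle. Then the trace of \<open>L\<^sub>2(H)\<^sup>2\<close> says that the sum of \<open>(deg v - 2)\<^sup>2\<close> is \<open>0\<close>.

  In a 2-regular graph, row \<open>v\<close> of \<open>L\<^sub>k(H)\<close> records the end points and weights of the two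
  non-backtracking walks of length \<open>k\<close> from \<open>v\<close>. Hence all these walks of length \<open>m\<close> are closed with
  weight \<open>-1\<close>, and so is every shortest closed one, since the quotient of the lengths is odd. If the
  shortest length \<open>k\<close> were less than \<open>m\<close>, the trace of \<open>L\<^sub>k(H)\<close> would be negative instead of \<open>0\<close>. So the
  graph is a single \<open>m\<close>-cycle of weight \<open>-1\<close>.
\<close>

subsection \<open>Traces and the characteristic polynomial\<close>

text \<open>These are the rescaled Chebyshev polynomials \<open>2 T_k(x/2)\<close>. Working with
  entries lets rows be read as walks later, and the size-one instance
  \<open>lucas 1 (\<lambda>_ _. e) k 0 0\<close> serves as evaluation at the scalar
  \<open>e\<close>.\<close>

fun lucas :: "nat \<Rightarrow> (nat \<Rightarrow> nat \<Rightarrow> 'a) \<Rightarrow> nat \<Rightarrow> nat \<Rightarrow> nat \<Rightarrow> 'a::comm_ring_1" where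
  "lucas n h 0 u v = (if u = v then 2 else 0)"
| "lucas n h (Suc 0) u v = h u v"
| "lucas n h (Suc (Suc k)) u v = (\<Sum>w<n. h u w * lucas n h (Suc k) w v) - lucas n h k u v"

text \<open>The same recursion on matrices, where similarity and triangularisation apply;
  \<open>lucas_mat_index\<close> links the two forms.\<close>

fun lucas_mat :: "'a::comm_ring_1 mat \<Rightarrow> nat \<Rightarrow> 'a mat" where
  "lucas_mat A 0 = 2 \<cdot>\<^sub>m 1\<^sub>m (dim_row A)"
| "lucas_mat A (Suc 0) = A"
| "lucas_mat A (Suc (Suc k)) = A * lucas_mat A (Suc k) - lucas_mat A k"

definition tr :: "'a::comm_ring_1 mat \<Rightarrow> 'a" where
  "tr A = (\<Sum>i<dim_row A. A $$ (i, i))"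

lemma lucas_mat_carrier:
  assumes "A \<in> carrier_mat n n"
  shows "lucas_mat A k \<in> carrier_mat n n"
  using assms by (induction A k rule: lucas_mat.induct) auto

lemma index_mult_mat_sum:
  assumes "A \<in> carrier_mat n n" "B \<in> carrier_mat n n" "i < n" "j < n"
  shows "(A * B) $$ (i, j) = (\<Sum>k<n. A $$ (i, k) * B $$ (k, j))"
  using assms by (auto simp: scalar_prod_def atLeast0LessThan intro!: sum.cong)

lemma lucas_mat_index:
  assumes "u < n" "v < n"
  shows "lucas_mat (mat n n (\<lambda>(i, j). h i j)) k $$ (u, v) = lucas n h k u v"
  using assms
proof (induction n h k u v rule: lucas.induct)
  case (3 n h k u v)
  let ?A = "mat n n (\<lambda>(i, j). h i j)"
  have c: "?A \<in> carrier_mat n n" by simp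
  have d: "dim_row (lucas_mat ?A k) = n" "dim_col (lucas_mat ?A k) = n" for k
    using lucas_mat_carrier[OF c, of k] by auto
  have "(?A * lucas_mat ?A (Suc k)) $$ (u, v) = (\<Sum>w<n. h u w * lucas n h (Suc k) w v)"
    using 3 by (subst index_mult_mat_sum[OF c lucas_mat_carrier[OF c]]) auto
  then show ?case using 3 by (simp add: d)
qed auto

lemma tr_mult_comm:
  assumes "A \<in> carrier_mat n n" "B \<in> carrier_mat n n"
  shows "tr (A * B) = tr (B * A)"
proof -
  have "tr (A * B) = (\<Sum>i<n. \<Sum>k<n. A $$ (i, k) * B $$ (k, i))"
    using assms by (simp add: tr_def index_mult_mat_sum[OF assms] del: index_mult_mat(1))
  also have "\<dots> = (\<Sum>k<n. \<Sum>i<n. B $$ (k, i) * A $$ (i, k))"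
    by (subst sum.swap) (simp add: mult.commute)
  also have "\<dots> = tr (B * A)"
    using assms by (simp add: tr_def index_mult_mat_sum[OF assms(2,1)] del: index_mult_mat(1))
  finally show ?thesis .
qed

lemma tr_similar:
  assumes "similar_mat_wit A B P Q"
  shows "tr A = tr B"
proof -
  define n where "n = dim_row A"
  note w = similar_mat_witD[OF n_def assms]
  note assoc = assoc_mult_mat[of _ n n _ n _ n]
  have "tr A = tr (P * (B * Q))" unfolding w(3) using w(4-) by (simp add: assoc)
  also have "\<dots> = tr (B * Q * P)" by (rule tr_mult_comm) (use w(4-) in auto)
  also have "B * Q * P = B" using w(2,4-) by (simp add: assoc)
  finally show ?thesis .
qed

text \<open>The witnesses \<open>P\<close> and \<open>Q\<close> stay explicit because similarity is
  in general compatible with products and differences only when all matrices are conjugated by the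
  same pair.\<close>

lemma similar_mat_wit_mult:
  assumes "similar_mat_wit A B P Q" "similar_mat_wit C D P Q"
  shows "similar_mat_wit (A * C) (B * D) P Q"
proof -
  define n where "n = dim_row A"
  note w = similar_mat_witD[OF n_def assms(1)]
  have "n = dim_row C" using w(6) similar_mat_witD(6)[OF refl assms(2)] by auto
  note v = similar_mat_witD[OF this assms(2)]
  note assoc = assoc_mult_mat[of _ n n _ n _ n]
  have "A * C = P * B * ((Q * P) * (D * Q))"
    unfolding w(3) v(3) using w(4-) v(4-) by (simp add: assoc)
  also have "\<dots> = P * (B * D) * Q"
    unfolding w(2) using w(4-) v(4-) by (simp add: assoc)
  finally show ?thesis
    by (rule similar_mat_witI[OF w(1,2)]) (use w(4-) v(4-) in auto)
qed

lemma similar_mat_wit_minus: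
  fixes A :: "'a::comm_ring_1 mat"
  assumes "similar_mat_wit A B P Q" "similar_mat_wit C D P Q"
  shows "similar_mat_wit (A - C) (B - D) P Q"
proof -
  define n where "n = dim_row A"
  note w = similar_mat_witD[OF n_def assms(1)]
  have "n = dim_row C" using w(6) similar_mat_witD(6)[OF refl assms(2)] by auto
  note v = similar_mat_witD[OF this assms(2)]
  have "P * (B - D) * Q = (P * B - P * D) * Q"
    using mult_minus_distrib_mat[OF w(6) w(5) v(5)] by simp
  also have "\<dots> = P * B * Q - P * D * Q"
    using w(4-) v(4-) by (intro minus_mult_distrib_mat) auto
  also have "\<dots> = A - C" using w(3) v(3) by simp
  finally have "A - C = P * (B - D) * Q" ..
  then show ?thesis
    by (rule similar_mat_witI[OF w(1,2)]) (use w(4-) v(4-) in auto)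
qed

lemma similar_mat_wit_lucas_mat:
  assumes "similar_mat_wit A B P Q"
  shows "similar_mat_wit (lucas_mat A k) (lucas_mat B k) P Q"
proof (induction k rule: induct_nat_012)
  case 0
  define n where "n = dim_row A"
  note w = similar_mat_witD[OF n_def assms]
  have "similar_mat_wit (1\<^sub>m n) (1\<^sub>m n) P Q"
    by (rule similar_mat_witI[OF w(1,2)]) (use w(1,6,7) in auto)
  then have "similar_mat_wit (2 \<cdot>\<^sub>m 1\<^sub>m n) (2 \<cdot>\<^sub>m 1\<^sub>m n) P Q"
    by (rule similar_mat_wit_smult)
  moreover have "dim_row B = n" using w(5) by (rule carrier_matD)
  ultimately show ?case by (simp add: n_def)
next
  case (ge2 k)
  then show ?case
    unfolding lucas_mat.simps by (intro similar_mat_wit_minus similar_mat_wit_mult assms)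
qed (use assms in simp)

lemma upper_triangular_mult:
  assumes "A \<in> carrier_mat n n" "B \<in> carrier_mat n n" "upper_triangular A" "upper_triangular B"
  shows "upper_triangular (A * B)"
    and "i < n \<Longrightarrow> (A * B) $$ (i, i) = A $$ (i, i) * B $$ (i, i)"
proof -
  have Az: "A $$ (i, k) = 0" if "k < i" "i < n" for i k using assms that by auto
  have Bz: "B $$ (i, k) = 0" if "k < i" "i < n" for i k using assms that by auto
  show "upper_triangular (A * B)"
  proof (rule upper_triangularI)
    fix i j assume "j < i" "i < dim_row (A * B)"
    then have ij: "j < i" "i < n" "j < n" using assms by auto
    have "A $$ (i, k) * B $$ (k, j) = 0" if "k < n" for k
      using Az[of k i] Bz[of j k] ij that by (cases "k < i") auto
    then show "(A * B) $$ (i, j) = 0"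
      using ij by (simp add: index_mult_mat_sum[OF assms(1,2)] del: index_mult_mat(1))
  qed
  assume i: "i < n"
  have "A $$ (i, k) * B $$ (k, i) = 0" if "k < n" "k \<noteq> i" for k
    using Az[of k i] Bz[of i k] i that by (cases "k < i") auto
  then have "(\<Sum>k<n. A $$ (i, k) * B $$ (k, i)) = (\<Sum>k\<in>{i}. A $$ (i, k) * B $$ (k, i))"
    using i by (intro sum.mono_neutral_right) auto
  then show "(A * B) $$ (i, i) = A $$ (i, i) * B $$ (i, i)"
    unfolding index_mult_mat_sum[OF assms(1,2) i i] by simp
qed

lemma upper_triangular_lucas_mat:
  assumes "B \<in> carrier_mat n n" "upper_triangular B"
  shows "upper_triangular (lucas_mat B k)
    \<and> (\<forall>i<n. lucas_mat B k $$ (i, i) = lucas 1 (\<lambda>_ _. B $$ (i, i)) k 0 0)"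
proof (induction k rule: induct_nat_012)
  case (ge2 k)
  note c = lucas_mat_carrier[OF assms(1)]
  have d: "dim_row (lucas_mat B k) = n" "dim_col (lucas_mat B k) = n" for k
    using c[of k] by auto
  have "upper_triangular (B * lucas_mat B (Suc k) - lucas_mat B k)"
    using upper_triangular_mult(1)[OF assms(1) c[of "Suc k"] assms(2)] ge2 assms d
    by (intro upper_triangularI) (simp add: upper_triangularD d del: index_mult_mat(1))
  moreover have "(B * lucas_mat B (Suc k) - lucas_mat B k) $$ (i, i)
      = lucas 1 (\<lambda>_ _. B $$ (i, i)) (Suc (Suc k)) 0 0" if "i < n" for i
    using upper_triangular_mult(2)[OF assms(1) c[of "Suc k"] assms(2)] ge2 assms d that
    by (simp del: index_mult_mat(1) add: d)
  ultimately show ?case by simp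
qed (use assms in auto)

text \<open>By Schur decomposition \<open>A\<close> is similar to an upper triangular
  \<open>B\<close> with diagonal \<open>es\<close>. The polynomials and their squares are similar
  through the same witnesses, and on triangular matrices they act on each diagonal entry
  separately.\<close>

lemma tr_lucas_mat_eq_sum_list:
  fixes A :: "complex mat"
  assumes A: "A \<in> carrier_mat n n" and es: "char_poly A = (\<Prod>e\<leftarrow>es. [:- e, 1:])"
  shows "tr (lucas_mat A k) = (\<Sum>e\<leftarrow>es. lucas 1 (\<lambda>_ _. e) k 0 0)"
    and "tr (lucas_mat A k * lucas_mat A k) = (\<Sum>e\<leftarrow>es. (lucas 1 (\<lambda>_ _. e) k 0 0)\<^sup>2)"
proof -
  obtain B P Q where "schur_decomposition A es = (B, P, Q)"
    by (cases "schur_decomposition A es") auto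
  from schur_decomposition[OF A es this]
  have sim: "similar_mat_wit A B P Q" and ut: "upper_triangular B" and diag: "diag_mat B = es"
    by auto
  have B: "B \<in> carrier_mat n n" using sim A by (auto simp: similar_mat_wit_def Let_def)
  note c = lucas_mat_carrier[OF B]
  have d: "dim_row (lucas_mat B k) = n" for k
    using c[of k] by auto
  have sum_es: "(\<Sum>e\<leftarrow>es. f e) = (\<Sum>i<n. f (B $$ (i, i)))" for f :: "complex \<Rightarrow> complex"
    using B unfolding diag[symmetric] diag_mat_def
    by (simp add: interv_sum_list_conv_sum_set_nat atLeast0LessThan comp_def)
  note L = upper_triangular_lucas_mat[OF B ut, of k]
  show "tr (lucas_mat A k) = (\<Sum>e\<leftarrow>es. lucas 1 (\<lambda>_ _. e) k 0 0)"
    unfolding tr_similar[OF similar_mat_wit_lucas_mat[OF sim]] sum_es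
    using L by (simp add: tr_def d)
  have "tr (lucas_mat A k * lucas_mat A k) = tr (lucas_mat B k * lucas_mat B k)"
    by (rule tr_similar[OF similar_mat_wit_mult]) (rule similar_mat_wit_lucas_mat[OF sim])+
  also have "\<dots> = (\<Sum>e\<leftarrow>es. (lucas 1 (\<lambda>_ _. e) k 0 0)\<^sup>2)"
    unfolding sum_es using L upper_triangular_mult(2)[OF c c, of k k]
    by (simp add: tr_def d power2_eq_square del: index_mult_mat(1))
  finally show "tr (lucas_mat A k * lucas_mat A k) = (\<Sum>e\<leftarrow>es. (lucas 1 (\<lambda>_ _. e) k 0 0)\<^sup>2)" .
qed

text \<open>Both sums are traces that depend only on the eigenvalues, and one list \<open>es\<close>
  factors both characteristic polynomials.\<close>

lemma lucas_trace_eq: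
  fixes g h :: "nat \<Rightarrow> nat \<Rightarrow> complex"
  assumes "char_poly (mat n n (\<lambda>(i, j). g i j)) = char_poly (mat n n (\<lambda>(i, j). h i j))"
  shows "(\<Sum>u<n. lucas n g k u u) = (\<Sum>u<n. lucas n h k u u)"
    and "(\<Sum>u<n. \<Sum>v<n. lucas n g k u v * lucas n g k v u)
       = (\<Sum>u<n. \<Sum>v<n. lucas n h k u v * lucas n h k v u)"
proof -
  let ?M = "\<lambda>h. mat n n (\<lambda>(i, j). h i j) :: complex mat"
  have c: "?M f \<in> carrier_mat n n" for f by simp
  obtain es where es: "char_poly (?M g) = (\<Prod>e\<leftarrow>es. [:- e, 1:])"
    using char_poly_factorized[OF c] by blast
  have d: "dim_row (lucas_mat (?M f) k) = n" for f
    using lucas_mat_carrier[OF c, of f k] by auto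
  have 1: "(\<Sum>u<n. lucas n f k u u) = tr (lucas_mat (?M f) k)" for f
    by (simp add: tr_def d lucas_mat_index)
  have 2: "(\<Sum>u<n. \<Sum>v<n. lucas n f k u v * lucas n f k v u)
      = tr (lucas_mat (?M f) k * lucas_mat (?M f) k)" for f
    by (simp add: tr_def d lucas_mat_index
        index_mult_mat_sum[OF lucas_mat_carrier[OF c] lucas_mat_carrier[OF c]] del: index_mult_mat(1))
  show "(\<Sum>u<n. lucas n g k u u) = (\<Sum>u<n. lucas n h k u u)"
    unfolding 1 tr_lucas_mat_eq_sum_list(1)[OF c es]
      tr_lucas_mat_eq_sum_list(1)[OF c es[unfolded assms]] ..
  show "(\<Sum>u<n. \<Sum>v<n. lucas n g k u v * lucas n g k v u)
       = (\<Sum>u<n. \<Sum>v<n. lucas n h k u v * lucas n h k v u)"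
    unfolding 2 tr_lucas_mat_eq_sum_list(2)[OF c es]
      tr_lucas_mat_eq_sum_list(2)[OF c es[unfolded assms]] ..
qed

subsection \<open>The polynomials of a matrix function\<close>

lemma Suc_mod_eq_iff:
  "Suc x mod m = Suc y mod m \<longleftrightarrow> x mod m = y mod (m :: nat)"
  by (auto simp: mod_Suc)

text \<open>Up to conjugation by the diagonal matrix of \<open>a\<close>, \<open>h\<close> is
  \<open>z + 1/z\<close> with \<open>z\<close> the negated cyclic shift, so the \<open>k\<close>-th
  polynomial gives \<open>z^k + 1/z^k\<close>. For \<open>k = 0\<close> the two indicators coincide
  and yield the value 2.\<close>

lemma lucas_signed_cycle:
  fixes h :: "nat \<Rightarrow> nat \<Rightarrow> complex"
  assumes m: "m \<ge> 3"
    and h: "\<And>u v. u < m \<Longrightarrow> v < m \<Longrightarrow>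
      h u v = (if v = Suc u mod m \<or> u = Suc v mod m then - cnj (a u) * a v else 0)"
    and a: "\<And>u. u < m \<Longrightarrow> cnj (a u) * a u = 1"
    and uv: "u < m" "v < m"
  shows "lucas m h k u v = (-1) ^ k * cnj (a u) * a v *
    ((if v = (u + k) mod m then 1 else 0) + (if u = (v + k) mod m then 1 else 0))"
  using uv
proof (induction k arbitrary: u v rule: induct_nat_012)
  case 0
  then show ?case using a by auto
next
  case 1
  have "\<not> (v = Suc u mod m \<and> u = Suc v mod m)"
    using 1 m by (auto simp: mod_Suc split: if_splits)
  then show ?case using 1 h by auto
next
  case (ge2 k)
  \<comment> \<open>The two neighbours of \<open>u\<close> on the cycle; adding \<open>m - 1\<close>
    gives the predecessor without truncated subtraction at 0.\<close>
  define p q where "p = Suc u mod m" and "q = (u + (m - 1)) mod m"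
  have pq: "p < m" "q < m" using m by (auto simp: p_def q_def)
  have Sq: "Suc q mod m = u" using ge2.prems m by (simp add: q_def mod_Suc_eq)
  have u_iff: "u = Suc w mod m \<longleftrightarrow> w = q" if "w < m" for w
    using Suc_mod_eq_iff[of w m q] that pq Sq by auto
  have ne: "p \<noteq> q"
    using Sq m pq(2) by (auto simp: p_def mod_Suc split: if_splits)
  define t where "t w = (if v = (w + Suc k) mod m then 1 else 0)
    + (if w = (v + Suc k) mod m then 1 else (0::complex))" for w
  have "(\<Sum>w<m. h u w * lucas m h (Suc k) w v)
      = (\<Sum>w<m. if w = p \<or> w = q then (-1) ^ Suc (Suc k) * cnj (a u) * a v * t w else 0)"
  proof (rule sum.cong)
    fix w assume "w \<in> {..<m}"
    then have w: "w < m" by simp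
    have hw: "h u w = (if w = p \<or> w = q then - cnj (a u) * a w else 0)"
      using h[OF ge2.prems(1) w] u_iff[OF w] unfolding p_def by presburger
    have lw: "lucas m h (Suc k) w v = (-1) ^ Suc k * cnj (a w) * a v * t w"
      using ge2.IH(2)[OF w ge2.prems(2)] unfolding t_def .
    have "- cnj (a u) * a w * ((-1) ^ Suc k * cnj (a w) * a v * t w)
        = (-1) ^ Suc (Suc k) * cnj (a u) * a v * t w * (cnj (a w) * a w)"
      by simp
    then show "h u w * lucas m h (Suc k) w v
       = (if w = p \<or> w = q then (-1) ^ Suc (Suc k) * cnj (a u) * a v * t w else 0)"
      unfolding hw lw a[OF w] by simp
  qed simp
  also have "\<dots> = (\<Sum>w\<in>{p, q}. (-1) ^ Suc (Suc k) * cnj (a u) * a v * t w)"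
    using pq by (intro sum.mono_neutral_cong_right) auto
  also have "\<dots> = (-1) ^ k * cnj (a u) * a v * (t p + t q)"
    using ne by (simp add: algebra_simps)
  finally have sum: "(\<Sum>w<m. h u w * lucas m h (Suc k) w v) = (-1) ^ k * cnj (a u) * a v * (t p + t q)" .
  have "(p + Suc k) mod m = (u + Suc (Suc k)) mod m"
    unfolding p_def by (metis add_Suc_shift mod_add_left_eq)
  moreover have "p = (v + Suc k) mod m \<longleftrightarrow> u = (v + k) mod m"
    using Suc_mod_eq_iff[of u m "v + k"] ge2.prems by (simp add: p_def)
  moreover have "(q + Suc k) mod m = (u + k) mod m"
    using Sq by (metis add_Suc_shift mod_add_left_eq)
  moreover have "q = (v + Suc k) mod m \<longleftrightarrow> u = (v + Suc (Suc k)) mod m"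
    using Suc_mod_eq_iff[of q m "v + Suc k"] pq Sq by auto
  ultimately show ?case
    using sum ge2.IH(1)[OF ge2.prems] by (simp add: t_def algebra_simps)
qed

text \<open>The recursion multiplies by \<open>h\<close> from the left only, while taking adjoints
  produces multiplication from the right; \<open>lucas_hermitian\<close> rests on their
  agreement.\<close>

lemma lucas_commute:
  assumes "u < n" "v < n"
  shows "(\<Sum>w<n. h u w * lucas n h k w v) = (\<Sum>w<n. lucas n h k u w * h w v)"
  using assms
proof (induction k arbitrary: u v rule: induct_nat_012)
  case 0
  have "(\<Sum>w<n. h u w * lucas n h 0 w v) = (\<Sum>w<n. if w = v then 2 * h u v else 0)"
    by (intro sum.cong) (auto simp: mult.commute)
  moreover have "(\<Sum>w<n. lucas n h 0 u w * h w v) = (\<Sum>w<n. if w = u then 2 * h u v else 0)"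
    by (intro sum.cong) auto
  ultimately show ?case using 0 by simp
next
  case (ge2 k)
  have "(\<Sum>w<n. h u w * (\<Sum>x<n. h w x * lucas n h (Suc k) x v))
      = (\<Sum>w<n. h u w * (\<Sum>x<n. lucas n h (Suc k) w x * h x v))"
    using ge2 by (intro sum.cong) auto
  also have "\<dots> = (\<Sum>x<n. (\<Sum>w<n. h u w * lucas n h (Suc k) w x) * h x v)"
    unfolding sum_distrib_left sum_distrib_right by (subst sum.swap) (simp add: mult.assoc)
  finally show ?case
    using ge2 by (simp add: algebra_simps sum_subtractf)
qed simp

lemma lucas_hermitian:
  fixes h :: "nat \<Rightarrow> nat \<Rightarrow> complex"
  assumes "\<And>u v. u < n \<Longrightarrow> v < n \<Longrightarrow> h v u = cnj (h u v)" "u < n" "v < n"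
  shows "lucas n h k v u = cnj (lucas n h k u v)"
  using assms(2,3)
proof (induction k arbitrary: u v rule: induct_nat_012)
  case 1
  then show ?case using assms(1)[of u v] by simp
next
  case (ge2 k)
  have "(\<Sum>w<n. h v w * lucas n h (Suc k) w u) = (\<Sum>w<n. lucas n h (Suc k) v w * h w u)"
    using ge2 by (intro lucas_commute)
  also have "\<dots> = (\<Sum>w<n. cnj (h u w * lucas n h (Suc k) w v))"
  proof (rule sum.cong)
    fix w assume "w \<in> {..<n}"
    then show "lucas n h (Suc k) v w * h w u = cnj (h u w * lucas n h (Suc k) w v)"
      using ge2.IH(2)[of w v] assms(1)[of u w] ge2.prems by simp
  qed simp
  finally have "(\<Sum>w<n. h v w * lucas n h (Suc k) w u) = (\<Sum>w<n. cnj (h u w * lucas n h (Suc k) w v))" .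
  then show ?case using ge2.IH(1)[OF ge2.prems] by simp
qed auto

text \<open>The hypothesis says that the diagonal matrix of \<open>x\<close> anticommutes with
  \<open>h\<close>, and the \<open>k\<close>-th polynomial contains only powers of the same parity
  as \<open>k\<close>.\<close>

lemma lucas_anticommute:
  assumes "\<And>u v. u < n \<Longrightarrow> v < n \<Longrightarrow> h u v \<noteq> 0 \<Longrightarrow> x u + x v = 0" "u < n" "v < n"
  shows "x u * lucas n h k u v = (-1) ^ k * (lucas n h k u v * x v)"
  using assms(2,3)
proof (induction k arbitrary: u v rule: induct_nat_012)
  case 1
  have "h u v = 0 \<or> x u = - x v" using assms(1)[OF 1] eq_neg_iff_add_eq_0 by blast
  then show ?case by (auto simp: mult.commute)
next
  case (ge2 k)
  have "x u * (\<Sum>w<n. h u w * lucas n h (Suc k) w v)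
      = (\<Sum>w<n. - (h u w * (x w * lucas n h (Suc k) w v)))"
    unfolding sum_distrib_left
  proof (rule sum.cong)
    fix w assume "w \<in> {..<n}"
    then have "h u w = 0 \<or> x u = - x w" using assms(1)[of u w] ge2 eq_neg_iff_add_eq_0 by blast
    then show "x u * (h u w * lucas n h (Suc k) w v) = - (h u w * (x w * lucas n h (Suc k) w v))"
      by (auto simp: algebra_simps)
  qed simp
  also have "\<dots> = (\<Sum>w<n. (-1) ^ k * (h u w * lucas n h (Suc k) w v) * x v)"
    using ge2 by (intro sum.cong) (auto simp: algebra_simps)
  also have "\<dots> = (-1) ^ k * ((\<Sum>w<n. h u w * lucas n h (Suc k) w v) * x v)"
    by (simp add: sum_distrib_left sum_distrib_right mult.assoc)
  finally show ?case using ge2 by (simp add: algebra_simps)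
qed auto

subsection \<open>Two-regularity\<close>

text \<open>This isolates what is used of a cospectral graph: a Hermitian matrix with entries 0 or
  fourth roots of unity, and a few traces. Their values are those of the cycle, computed in
  \<open>lucas_signed_cycle_traces\<close>.\<close>

locale cospectral_matrix =
  fixes m :: nat and h :: "nat \<Rightarrow> nat \<Rightarrow> complex"
  assumes m3: "3 \<le> m" and odd_m: "odd m"
    and herm: "\<And>u v. u < m \<Longrightarrow> v < m \<Longrightarrow> h v u = cnj (h u v)"
    and loopless: "\<And>u. u < m \<Longrightarrow> h u u = 0"
    and entries: "\<And>u v. u < m \<Longrightarrow> v < m \<Longrightarrow> h u v \<in> {0, 1, -1, \<i>, -\<i>}"
    and trace_less: "\<And>k. 0 < k \<Longrightarrow> k < m \<Longrightarrow> (\<Sum>u<m. lucas m h k u u) = 0"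
    and trace_m: "(\<Sum>u<m. lucas m h m u u) = - (2 * of_nat m)"
    and trace_square_m: "(\<Sum>u<m. \<Sum>v<m. lucas m h m u v * lucas m h m v u) = 4 * of_nat m"
    and trace_square_2: "(\<Sum>u<m. \<Sum>v<m. lucas m h 2 u v * lucas m h 2 v u) = 2 * of_nat m"
begin

definition nb :: "nat \<Rightarrow> nat set" where
  "nb u = {v. v < m \<and> h u v \<noteq> 0}"

lemma finite_nb [simp]: "finite (nb u)"
  by (simp add: nb_def)

lemma nb_less: "v \<in> nb u \<Longrightarrow> v < m"
  by (simp add: nb_def)

lemma nb_sym: "u < m \<Longrightarrow> v < m \<Longrightarrow> v \<in> nb u \<longleftrightarrow> u \<in> nb v"
  using herm[of u v] by (simp add: nb_def)

lemma nb_irrefl: "u < m \<Longrightarrow> u \<notin> nb u"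
  by (simp add: nb_def loopless)

lemma entry_mult_entry:
  assumes "u < m" "v < m"
  shows "h u v * h v u = (if v \<in> nb u then 1 else 0)"
  using entries[OF assms] herm[OF assms] assms by (auto simp: nb_def)

text \<open>The matrix \<open>L + 2 I\<close>, with \<open>L\<close> the \<open>m\<close>-th
  polynomial, is Hermitian, so its squared Frobenius norm is
  \<open>tr (L^2) + 4 tr L + 4 m = 4 m - 8 m + 4 m = 0\<close>.\<close>

lemma lucas_m:
  assumes "u < m" "v < m"
  shows "lucas m h m u v = (if u = v then -2 else 0)"
proof -
  let ?L = "lucas m h m"
  define f where "f u v = (cmod (?L u v + (if u = v then 2 else 0)))\<^sup>2" for u v
  have "complex_of_real (f u v) = ?L u v * ?L v u + (if u = v then 4 * ?L u u + 4 else 0)"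
    if "u < m" "v < m" for u v
  proof -
    have "cnj (?L u v) = ?L v u" using lucas_hermitian[OF herm that] by simp
    then show ?thesis
      unfolding f_def complex_norm_square by (auto simp: algebra_simps)
  qed
  then have "complex_of_real (\<Sum>u<m. \<Sum>v<m. f u v)
      = (\<Sum>u<m. \<Sum>v<m. ?L u v * ?L v u) + (\<Sum>u<m. 4 * ?L u u + 4)"
    by (simp add: sum.distrib)
  also have "\<dots> = 0"
    by (simp add: trace_square_m sum.distrib trace_m flip: sum_distrib_left)
  finally have "(\<Sum>u<m. \<Sum>v<m. f u v) = 0" by (simp only: of_real_eq_0_iff)
  moreover have "0 \<le> f u v" for u v by (simp add: f_def)
  ultimately have "f u v = 0"
    using assms by (simp add: sum_nonneg_eq_0_iff sum_nonneg)
  then have "?L u v + (if u = v then 2 else 0) = 0" by (simp add: f_def)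
  then show ?thesis by (auto simp: eq_neg_iff_add_eq_0 split: if_splits)
qed

lemma lucas_2: "lucas m h 2 u v = (\<Sum>w<m. h u w * h w v) - (if u = v then 2 else 0)"
  by (simp add: numeral_2_eq_2)

lemma lucas_2_diag:
  assumes "u < m"
  shows "lucas m h 2 u u = of_nat (card (nb u)) - 2"
proof -
  have "(\<Sum>w<m. h u w * h w u) = (\<Sum>w<m. if w \<in> nb u then 1 else 0)"
    using assms entry_mult_entry by (intro sum.cong) auto
  also have "\<dots> = of_nat (card ({..<m} \<inter> nb u))" by (simp add: sum.If_cases)
  also have "{..<m} \<inter> nb u = nb u" using nb_less by auto
  finally show ?thesis by (simp add: lucas_2)
qed

lemma sum_degrees: "(\<Sum>u<m. card (nb u)) = 2 * m"
proof -
  have "(\<Sum>u<m. lucas m h 2 u u) = 0" using m3 by (intro trace_less) auto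
  then have "(\<Sum>u<m. of_nat (card (nb u)) - 2 :: complex) = 0" by (simp add: lucas_2_diag)
  then have "of_nat (\<Sum>u<m. card (nb u)) = (of_nat (2 * m) :: complex)"
    by (simp add: sum_subtractf)
  then show ?thesis by (simp only: of_nat_eq_iff)
qed

text \<open>Such an \<open>x\<close> anticommutes with \<open>h\<close>. As \<open>m\<close> is odd,
  the diagonal entry of \<open>lucas_m\<close> at \<open>u\<close> gives
  \<open>-2 x u = 2 x u\<close>. In graph terms, no component is bipartite.\<close>

lemma opposite_on_edges_imp_zero:
  assumes "\<And>u v. u < m \<Longrightarrow> v \<in> nb u \<Longrightarrow> x u + x v = 0" "u < m"
  shows "x u = (0 :: complex)"
proof -
  have "x u * lucas m h m u u = (-1) ^ m * (lucas m h m u u * x u)"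
    using assms by (intro lucas_anticommute) (auto simp: nb_def)
  then show ?thesis using odd_m assms(2) by (simp add: lucas_m)
qed

text \<open>Each edge is listed once, with its smaller end first, so that the edges can index the
  columns of the incidence matrix.\<close>

definition edge_pairs :: "(nat \<times> nat) set" where
  "edge_pairs = {(u, v). u < v \<and> u < m \<and> v \<in> nb u}"

lemma finite_edge_pairs: "finite edge_pairs"
  by (rule finite_subset[of _ "{..<m} \<times> {..<m}"]) (auto simp: edge_pairs_def nb_less)

lemma card_edge_pairs: "card edge_pairs = m"
proof -
  have "Sigma {..<m} nb = edge_pairs \<union> prod.swap ` edge_pairs"
  proof (intro equalityI subsetI)
    fix p assume "p \<in> Sigma {..<m} nb"
    then obtain u v where p: "p = (u, v)" "u < m" "v \<in> nb u" by auto
    then have "u \<noteq> v" "u \<in> nb v" "v < m" using nb_irrefl nb_sym nb_less by blast+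
    then show "p \<in> edge_pairs \<union> prod.swap ` edge_pairs"
      using p by (cases "u < v") (auto simp: edge_pairs_def image_iff)
  qed (auto simp: edge_pairs_def nb_less nb_sym)
  moreover have "edge_pairs \<inter> prod.swap ` edge_pairs = {}" by (auto simp: edge_pairs_def)
  moreover have "card (prod.swap ` edge_pairs) = card edge_pairs"
    by (intro card_image) auto
  ultimately have "card (Sigma {..<m} nb) = 2 * card edge_pairs"
    using finite_edge_pairs by (simp add: card_Un_disjoint)
  moreover have "card (Sigma {..<m} nb) = 2 * m" by (simp add: sum_degrees)
  ultimately show ?thesis by simp
qed

text \<open>The incidence matrix is square, and by \<open>opposite_on_edges_imp_zero\<close> its transpose is
  injective; so it is injective itself, while an even closed walk without repeated edges
  would give a kernel vector with alternating signs.\<close>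

lemma no_four_cycle:
  assumes a: "a < m" and c: "c < m" "a \<noteq> c" and b: "b \<in> nb a" "b \<in> nb c"
    and d: "d \<in> nb a" "d \<in> nb c"
  shows "b = d"
proof (rule ccontr)
  assume bd: "b \<noteq> d"
  obtain e where e: "bij_betw e {..<m} edge_pairs"
    using ex_bij_betw_nat_finite[OF finite_edge_pairs] unfolding card_edge_pairs atLeast0LessThan
    by blast
  define M where "M = mat m m (\<lambda>(v, k). (if fst (e k) = v then 1 else 0) + (if snd (e k) = v then 1 else (0 :: complex)))"
  have M: "M \<in> carrier_mat m m" by (simp add: M_def)
  \<comment> \<open>The unit vector of the edge between \<open>p\<close> and \<open>q\<close>. Both
    orders are allowed because \<open>e\<close> lists an edge in increasing order only.\<close>
  define \<epsilon> where "\<epsilon> p q k = (if e k = (p, q) \<or> e k = (q, p) then 1 else (0 :: complex))" for p q k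
  have index: "\<exists>k<m. e k = (p, q) \<or> e k = (q, p)" if "p < m" "q \<in> nb p" for p q
  proof -
    have "p \<noteq> q" "p \<in> nb q" "q < m" using that nb_irrefl nb_sym nb_less by blast+
    then have "(p, q) \<in> edge_pairs \<or> (q, p) \<in> edge_pairs"
      using that by (auto simp: edge_pairs_def)
    then have "(p, q) \<in> e ` {..<m} \<or> (q, p) \<in> e ` {..<m}" using e by (simp add: bij_betw_def)
    then show ?thesis by (force simp: image_iff)
  qed
  have M\<epsilon>: "(\<Sum>k<m. M $$ (v, k) * \<epsilon> p q k) = (if p = v then 1 else 0) + (if q = v then 1 else 0)"
    if pq: "p < m" "q \<in> nb p" and v: "v < m" for p q v
  proof -
    obtain k where k: "k < m" "e k = (p, q) \<or> e k = (q, p)" using index[OF pq] by blast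
    have "\<not> (e j = (p, q) \<or> e j = (q, p))" if "j < m" "j \<noteq> k" for j
    proof
      assume j: "e j = (p, q) \<or> e j = (q, p)"
      have "e j \<in> edge_pairs" "e k \<in> edge_pairs" "e j \<noteq> e k"
        using e that k(1) by (auto simp: bij_betw_def inj_on_def)
      then show False using j k(2) by (auto simp: edge_pairs_def)
    qed
    with k have "(\<Sum>k<m. M $$ (v, k) * \<epsilon> p q k) = (\<Sum>k\<in>{k}. M $$ (v, k) * \<epsilon> p q k)"
      by (intro sum.mono_neutral_right) (auto simp: \<epsilon>_def)
    also have "\<dots> = M $$ (v, k)" using k(2) by (simp add: \<epsilon>_def)
    also have "\<dots> = (if p = v then 1 else 0) + (if q = v then 1 else 0)"
      using k v by (elim disjE) (simp_all add: M_def)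
    finally show ?thesis .
  qed
  have bdm: "b < m" "d < m" using b d nb_less by auto
  have nbs: "c \<in> nb b" "a \<in> nb d" using b d a c bdm nb_sym by blast+
  define y where "y k = \<epsilon> a b k - \<epsilon> b c k + \<epsilon> c d k - \<epsilon> d a k" for k
  have "(\<Sum>k<m. M $$ (v, k) * y k) = 0" if "v < m" for v
    using M\<epsilon>[OF a b(1) that] M\<epsilon>[OF bdm(1) nbs(1) that] M\<epsilon>[OF c(1) d(2) that] M\<epsilon>[OF bdm(2) nbs(2) that]
    by (simp add: y_def algebra_simps sum.distrib sum_subtractf)
  then have My: "M *\<^sub>v vec m y = 0\<^sub>v m"
    using M by (intro eq_vecI) (auto simp: scalar_prod_def atLeast0LessThan)
  obtain k where k: "k < m" "e k = (a, b) \<or> e k = (b, a)" using index[OF a b(1)] by blast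
  \<comment> \<open>At the edge between \<open>a\<close> and \<open>b\<close> only the first of the
    four terms of \<open>y\<close> survives: the other three edges are different from it because
    \<open>b \<noteq> d\<close> and \<open>a \<noteq> c\<close>.\<close>
  have "a \<noteq> b" "c \<noteq> d" using nb_irrefl a b c d by auto
  then have "y k \<noteq> 0" using k(2) bd c(2) by (auto simp: y_def \<epsilon>_def)
  then have "vec m y \<noteq> 0\<^sub>v m" using k(1) by (metis index_vec index_zero_vec(1))
  then have "det M = 0" using My vec_carrier[of m y] det_0_iff_vec_prod_zero[OF M] by blast
  then have "det (transpose_mat M) = 0" using det_transpose[OF M] by simp
  then obtain x where x: "x \<in> carrier_vec m" "x \<noteq> 0\<^sub>v m" "transpose_mat M *\<^sub>v x = 0\<^sub>v m"
    using det_0_iff_vec_prod_zero[of "transpose_mat M" m] M by auto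
  have edge: "x $ fst (e k) + x $ snd (e k) = 0" if "k < m" for k
  proof -
    have ek: "fst (e k) < m" "snd (e k) < m"
      using e that by (auto simp: bij_betw_def edge_pairs_def dest!: nb_less equalityD1)
    have "0 = (transpose_mat M *\<^sub>v x) $ k" using x(3) that by simp
    also have "\<dots> = (\<Sum>v<m. M $$ (v, k) * x $ v)"
      using M x(1) that by (auto simp: scalar_prod_def atLeast0LessThan)
    also have "\<dots> = (\<Sum>v<m. (if fst (e k) = v then x $ v else 0) + (if snd (e k) = v then x $ v else 0))"
      using that by (intro sum.cong) (auto simp: M_def)
    also have "\<dots> = x $ fst (e k) + x $ snd (e k)" using ek by (simp add: sum.distrib)
    finally show ?thesis ..
  qed
  have "x $ u = 0" if "u < m" for u
  proof (rule opposite_on_edges_imp_zero[where x = "\<lambda>u. x $ u", OF _ that])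
    fix u v assume "u < m" "v \<in> nb u"
    then obtain k where "k < m" "e k = (u, v) \<or> e k = (v, u)" using index by blast
    then show "x $ u + x $ v = 0" using edge[of k] by (auto simp: add.commute)
  qed
  then have "x = 0\<^sub>v m" using x(1) by (intro eq_vecI) auto
  then show False using x(2) by simp
qed

text \<open>The trace of the squared second polynomial counts pairs with a common neighbour, apart
  from its diagonal. Counting these pairs from the middle vertex gives the sum of the
  \<open>(d w)\<^sup>2\<close>. With degree sum \<open>2 m\<close> this leaves a vanishing sum of
  squares.\<close>

lemma degree_eq_2:
  assumes "u < m"
  shows "card (nb u) = 2"
proof -
  define d where "d u = int (card (nb u))" for u
  \<comment> \<open>Off the diagonal there is at most one common neighbour, and its weight times the
    reversed weight is 1. On the diagonal, \<open>- d u\<close> compensates for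
    \<open>nb u \<inter> nb u\<close> having \<open>d u\<close> elements.\<close>
  have entry: "lucas m h 2 u v * lucas m h 2 v u
      = of_int ((if u = v then (d u - 2)\<^sup>2 - d u else 0) + int (card (nb u \<inter> nb v)))"
    if "u < m" "v < m" for u v
  proof (cases "u = v")
    case True
    then show ?thesis using that by (simp add: lucas_2_diag d_def power2_eq_square)
  next
    case False
    have sub: "(\<Sum>w<m. h u w * h w v) = (\<Sum>w\<in>nb u \<inter> nb v. h u w * h w v)"
      if "u < m" "v < m" for u v
    proof (rule sum.mono_neutral_right)
      show "\<forall>w\<in>{..<m} - nb u \<inter> nb v. h u w * h w v = 0"
        using that nb_sym by (auto simp: nb_def)
    qed (auto dest: nb_less)
    show ?thesis
    proof (cases "nb u \<inter> nb v = {}")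
      case True
      then show ?thesis using False sub[OF that] by (simp add: lucas_2)
    next
      case nonempty: False
      then obtain w where w: "w \<in> nb u" "w \<in> nb v" by blast
      then have eq: "nb u \<inter> nb v = {w}" using no_four_cycle[OF that False] by blast
      have wm: "w < m" "u \<in> nb w" "v \<in> nb w" using w nb_less nb_sym that by blast+
      have "lucas m h 2 u v * lucas m h 2 v u = (h u w * h w u) * (h w v * h v w)"
        using False sub[OF that] sub[OF that(2,1)] eq by (simp add: lucas_2 Int_commute)
      also have "\<dots> = 1" using entry_mult_entry that w wm by simp
      finally show ?thesis using False eq by simp
    qed
  qed
  have "of_int (\<Sum>u<m. \<Sum>v<m. (if u = v then (d u - 2)\<^sup>2 - d u else 0) + int (card (nb u \<inter> nb v)))
      = (\<Sum>u<m. \<Sum>v<m. lucas m h 2 u v * lucas m h 2 v u)"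
    unfolding of_int_sum by (intro sum.cong refl) (simp only: entry lessThan_iff)
  then have "(of_int (\<Sum>u<m. \<Sum>v<m. (if u = v then (d u - 2)\<^sup>2 - d u else 0) + int (card (nb u \<inter> nb v))) :: complex)
      = of_int (2 * int m)"
    unfolding trace_square_2 by simp
  then have "(\<Sum>u<m. \<Sum>v<m. (if u = v then (d u - 2)\<^sup>2 - d u else 0) + int (card (nb u \<inter> nb v))) = 2 * int m"
    by (simp only: of_int_eq_iff)
  then have 1: "(\<Sum>u<m. (d u - 2)\<^sup>2 - d u) + (\<Sum>u<m. \<Sum>v<m. int (card (nb u \<inter> nb v))) = 2 * int m"
    by (simp add: sum.distrib)
  have deg: "d w = (\<Sum>u<m. if u \<in> nb w then 1 else 0)" for w
  proof -
    have "{..<m} \<inter> nb w = nb w" using nb_less by auto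
    then show ?thesis by (simp add: d_def sum.If_cases)
  qed
  have "(\<Sum>u<m. \<Sum>v<m. int (card (nb u \<inter> nb v)))
      = (\<Sum>u<m. \<Sum>v<m. \<Sum>w<m. (if u \<in> nb w then 1 else 0) * (if v \<in> nb w then 1 else 0))"
  proof (intro sum.cong refl)
    fix u v assume uv: "u \<in> {..<m}" "v \<in> {..<m}"
    have "(\<Sum>w<m. (if u \<in> nb w then 1 else 0) * (if v \<in> nb w then 1 else (0::int)))
        = (\<Sum>w\<in>nb u \<inter> nb v. 1)"
      using uv nb_sym by (intro sum.mono_neutral_cong_right) (auto dest: nb_less)
    also have "\<dots> = int (card (nb u \<inter> nb v))" by simp
    finally show "int (card (nb u \<inter> nb v))
      = (\<Sum>w<m. (if u \<in> nb w then 1 else 0) * (if v \<in> nb w then 1 else 0))" ..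
  qed
  also have "\<dots> = (\<Sum>u<m. \<Sum>w<m. \<Sum>v<m. (if u \<in> nb w then 1 else 0) * (if v \<in> nb w then 1 else 0))"
    by (intro sum.cong refl sum.swap)
  also have "\<dots> = (\<Sum>w<m. \<Sum>u<m. \<Sum>v<m. (if u \<in> nb w then 1 else 0) * (if v \<in> nb w then 1 else 0))"
    by (rule sum.swap)
  also have "\<dots> = (\<Sum>w<m. (d w)\<^sup>2)"
    unfolding deg power2_eq_square sum_product ..
  finally have 2: "(\<Sum>u<m. \<Sum>v<m. int (card (nb u \<inter> nb v))) = (\<Sum>w<m. (d w)\<^sup>2)" .
  have 3: "(\<Sum>u<m. d u) = 2 * int m"
    using arg_cong[OF sum_degrees, of int] by (simp add: d_def)
  have "(\<Sum>u<m. 2 * (d u - 2)\<^sup>2) = (\<Sum>u<m. ((d u - 2)\<^sup>2 - d u) + (d u)\<^sup>2 - 3 * d u + 4)"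
    by (intro sum.cong) (auto simp: power2_eq_square algebra_simps)
  also have "\<dots> = 0"
    using 1 2 3 by (simp add: sum.distrib sum_subtractf flip: sum_distrib_left)
  finally have "(\<Sum>u<m. 2 * (d u - 2)\<^sup>2) = 0" .
  then have "2 * (d u - 2)\<^sup>2 = 0"
    using assms by (subst (asm) sum_nonneg_eq_0_iff) auto
  then show ?thesis by (simp add: d_def)
qed

end

subsection \<open>Non-backtracking walks\<close>

lemma Suc_mod_neq:
  assumes "3 \<le> m" "i < m" "Suc p mod m = i" "p < m"
  shows "p \<noteq> Suc i mod m"
  using assms by (auto simp: mod_Suc split: if_splits)

text \<open>An odd power permutes the fourth roots of unity and fixes -1.\<close>

lemma fourth_root_odd_power:
  assumes "x \<in> {1, -1, \<i>, -\<i>}" "odd q" "x ^ q = -1"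
  shows "x = -1"
proof -
  obtain t where t: "q = 2 * t + 1" using assms(2) by (rule oddE)
  have "(x\<^sup>2) ^ t * x = -1"
    using assms(3) unfolding t by (simp only: power_add power_mult power_one_right)
  moreover have "(x\<^sup>2) ^ t = 1 \<or> (x\<^sup>2) ^ t = -1"
    using assms(1) by (cases "even t") auto
  ultimately show ?thesis using assms(1) by (auto simp: complex_eq_iff)
qed

context cospectral_matrix
begin

text \<open>The vertex at which a walk coming from \<open>a\<close> continues after
  \<open>b\<close>. It is determined by 2-regularity when \<open>a\<close> is a neighbour of
  \<open>b\<close>.\<close>

definition other :: "nat \<Rightarrow> nat \<Rightarrow> nat" where
  "other a b = (THE c. c \<in> nb b \<and> c \<noteq> a)"

lemma nb_eq_other:
  assumes "b < m" "a \<in> nb b"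
  shows "nb b = {a, other a b}" "other a b \<noteq> a"
proof -
  obtain x y where xy: "nb b = {x, y}" "x \<noteq> y"
    using degree_eq_2[OF assms(1)] by (auto simp: card_2_iff)
  then have "\<exists>!c. c \<in> nb b \<and> c \<noteq> a" using assms(2) by auto
  then have "other a b \<in> nb b \<and> other a b \<noteq> a" unfolding other_def by (rule theI')
  then show "nb b = {a, other a b}" "other a b \<noteq> a" using xy assms(2) by auto
qed

lemma other_mem: "b < m \<Longrightarrow> a \<in> nb b \<Longrightarrow> other a b \<in> nb b"
  using nb_eq_other(1) by blast

lemma other_eq:
  assumes "b < m" "a \<in> nb b" "c \<in> nb b" "c \<noteq> a"
  shows "other a b = c"
  using nb_eq_other[OF assms(1,2)] assms(3,4) by auto

lemma other_other: "b < m \<Longrightarrow> a \<in> nb b \<Longrightarrow> other (other a b) b = a"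
  using nb_eq_other other_eq other_mem by metis

text \<open>The non-backtracking walk starting with the step \<open>a \<rightarrow> b\<close>.\<close>

fun walk :: "nat \<Rightarrow> nat \<Rightarrow> nat \<Rightarrow> nat" where
  "walk a b 0 = a"
| "walk a b (Suc k) = walk b (other a b) k"

fun weight :: "nat \<Rightarrow> nat \<Rightarrow> nat \<Rightarrow> complex" where
  "weight a b 0 = 1"
| "weight a b (Suc k) = h a b * weight b (other a b) k"

lemma walk_add: "walk a b (k + j) = walk (walk a b k) (walk a b (Suc k)) j"
  by (induction k arbitrary: a b) auto

lemma weight_add: "weight a b (k + j) = weight a b k * weight (walk a b k) (walk a b (Suc k)) j"
  by (induction k arbitrary: a b) auto

lemma other_step:
  assumes "a < m" "b \<in> nb a"
  shows "b < m" "other a b \<in> nb b"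
  using assms nb_less other_mem nb_sym by blast+

lemma walk_step:
  assumes "a < m" "b \<in> nb a"
  shows "walk a b k < m \<and> walk a b (Suc k) \<in> nb (walk a b k)"
  using assms by (induction k arbitrary: a b) (auto simp: other_step)

lemma weight_mem:
  assumes "a < m" "b \<in> nb a"
  shows "weight a b k \<in> {1, -1, \<i>, -\<i>}"
  using assms
proof (induction k arbitrary: a b)
  case (Suc k)
  have "weight b (other a b) k \<in> {1, -1, \<i>, -\<i>}" using Suc other_step by blast
  moreover have "h a b \<in> {1, -1, \<i>, -\<i>}"
    using entries[OF Suc.prems(1) nb_less[OF Suc.prems(2)]] Suc.prems(2) by (auto simp: nb_def)
  ultimately show ?case by auto
qed simp

definition arrival :: "nat \<Rightarrow> nat \<Rightarrow> nat \<Rightarrow> nat \<Rightarrow> complex" where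
  "arrival a b k x = (if x = walk a b k then weight a b k else 0)"

lemma arrival_Suc: "arrival a b (Suc k) x = h a b * arrival b (other a b) k x"
  by (simp add: arrival_def)

text \<open>The recursion defining \<open>lucas\<close> subtracts exactly the backtracking walks.\<close>

lemma lucas_eq_arrival:
  assumes "v < m" "w \<in> nb v" "x < m"
  shows "lucas m h k v x = arrival v w k x + arrival v (other w v) k x"
  using assms
proof (induction k arbitrary: v w rule: induct_nat_012)
  case 0
  then show ?case by (simp add: arrival_def)
next
  case 1
  have "x \<noteq> w \<Longrightarrow> x \<noteq> other w v \<Longrightarrow> h v x = 0"
    using nb_eq_other(1)[OF 1(1,2)] 1(3) by (auto simp: nb_def)
  then show ?case using nb_eq_other(2)[OF 1(1,2)] by (auto simp: arrival_def)
next
  case (ge2 k)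
  define w' where "w' = other w v"
  have w': "nb v = {w, w'}" "w' \<noteq> w" "other w' v = w" "w' \<in> nb v"
    using nb_eq_other[OF ge2.prems(1,2)] other_other[OF ge2.prems(1,2)] by (auto simp: w'_def)
  \<comment> \<open>From \<open>y\<close> one walk goes on, extending the step from
    \<open>v\<close>. The other returns to \<open>v\<close>, where the two entries cancel to 1, and
    leaves through the other neighbour. Over both \<open>y\<close> the returning terms add up to the
    \<open>k\<close>-th polynomial.\<close>
  have step: "h v y * lucas m h (Suc k) y x = arrival v y (Suc (Suc k)) x + arrival v (other y v) k x"
    if y: "y \<in> nb v" for y
  proof -
    have ym: "y < m" "v \<in> nb y" using y ge2.prems nb_less nb_sym by blast+
    have "lucas m h (Suc k) y x = arrival y v (Suc k) x + arrival y (other v y) (Suc k) x"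
      using ge2.IH(2)[OF ym ge2.prems(3)] .
    then have "h v y * lucas m h (Suc k) y x
        = (h v y * h y v) * arrival v (other y v) k x + h v y * arrival y (other v y) (Suc k) x"
      by (simp add: arrival_Suc algebra_simps)
    also have "h v y * h y v = 1" using entry_mult_entry ge2.prems(1) ym y by simp
    also have "h v y * arrival y (other v y) (Suc k) x = arrival v y (Suc (Suc k)) x"
      by (simp only: arrival_Suc)
    finally show ?thesis by simp
  qed
  have "(\<Sum>y<m. h v y * lucas m h (Suc k) y x) = (\<Sum>y\<in>{w, w'}. h v y * lucas m h (Suc k) y x)"
    unfolding w'(1)[symmetric] by (rule sum.mono_neutral_right) (auto simp: nb_def)
  also have "\<dots> = arrival v w (Suc (Suc k)) x + arrival v w' k x
      + (arrival v w' (Suc (Suc k)) x + arrival v w k x)"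
    using w'(2-4) step[OF ge2.prems(2)] step[OF w'(4)] by (simp add: w'_def[symmetric])
  finally show ?case
    using ge2.IH(1)[OF ge2.prems] by (simp add: w'_def)
qed

text \<open>The diagonal entry -2 is a sum of two terms, each 0 or a fourth root of unity, so both
  terms are -1.\<close>

lemma walk_m:
  assumes "a < m" "b \<in> nb a"
  shows "walk a b m = a" "weight a b m = -1"
proof -
  have "arrival a b m a + arrival a (other b a) m a = -2"
    using lucas_eq_arrival[OF assms assms(1), of m] lucas_m[OF assms(1) assms(1)] by simp
  moreover have "weight a b m \<in> {1, -1, \<i>, -\<i>}" "weight a (other b a) m \<in> {1, -1, \<i>, -\<i>}"
    using weight_mem assms other_mem by blast+
  ultimately have "a = walk a b m \<and> weight a b m = -1"
    by (auto simp: arrival_def complex_eq_iff split: if_splits)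
  then show "walk a b m = a" "weight a b m = -1" by auto
qed

text \<open>Only the starting vertex has to recur, not the direction of the walk;
  \<open>first_return\<close> recovers the direction for minimal lengths.\<close>

definition returns :: "nat \<Rightarrow> bool" where
  "returns k \<longleftrightarrow> 0 < k \<and> (\<exists>a b. a < m \<and> b \<in> nb a \<and> walk a b k = a)"

text \<open>A shortest closed walk continues periodically. Hence \<open>k\<close> divides
  \<open>m\<close>, as the remainder would be an earlier return, and the weight raised to the odd
  power \<open>m / k\<close> is -1.\<close>

lemma first_return:
  assumes k: "0 < k" "\<And>j. j < k \<Longrightarrow> \<not> returns j"
    and ab: "a < m" "b \<in> nb a" and ret: "walk a b k = a"
  shows "weight a b k = -1"
proof -
  have "k \<noteq> 1" using ret ab nb_irrefl by auto
  then obtain j where j: "k = Suc (Suc j)" using k(1) by (metis One_nat_def gr0_conv_Suc not0_implies_Suc)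
  define z where "z = walk a b (Suc j)"
  have z: "z < m" "a \<in> nb z" "z \<in> nb a"
    using walk_step[OF ab, of "Suc j"] ret ab(1) nb_sym by (auto simp: j z_def)
  \<comment> \<open>If the walk came back through the edge it left by, removing its first and last
    step would leave a shorter closed walk at \<open>b\<close>. For length 2 this would be a
    backtrack, which \<open>other\<close> excludes.\<close>
  have "z \<noteq> b"
  proof
    assume "z = b"
    then have return: "walk b (other a b) j = b" by (simp add: z_def)
    show False
    proof (cases j)
      case 0
      have "a \<in> nb b" "b < m" using ab nb_sym nb_less by blast+
      then show False using nb_eq_other(2) ret by (auto simp: j 0)
    next
      case (Suc i)
      then have "returns j" using other_step[OF ab] return unfolding returns_def by blast
      then show False using k(2)[of j] j by simp
    qed
  qed
  then have "walk a b (Suc k) = b"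
    using walk_add[of a b "Suc j" 2] ret other_eq[OF ab(1) z(3) ab(2)]
    by (simp add: j z_def numeral_2_eq_2)
  then have per: "walk a b (k + i) = walk a b i" "weight a b (k + i) = weight a b k * weight a b i" for i
    using ret by (simp_all only: walk_add[of a b k] weight_add[of a b k])
  have per': "walk a b (q * k + i) = walk a b i \<and> weight a b (q * k + i) = weight a b k ^ q * weight a b i" for q i
    by (induction q) (simp_all add: per add.assoc)
  define q r where "q = m div k" and "r = m mod k"
  have m: "m = q * k + r" by (simp add: q_def r_def)
  have "walk a b r = a" using per'[of q r] walk_m(1)[OF ab] m by simp
  moreover have "\<not> returns r" using k(1) by (intro k(2)) (simp add: r_def)
  ultimately have "r = 0" using ab by (auto simp: returns_def)
  then have "m = q * k" using m by simp
  then have "odd q" using odd_m by auto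
  have "weight a b k ^ q = weight a b (q * k)" using per'[of q 0] by simp
  also have "\<dots> = -1" using walk_m(2)[OF ab] \<open>m = q * k\<close> by metis
  finally have "weight a b k ^ q = -1" .
  then show ?thesis using fourth_root_odd_power weight_mem[OF ab] \<open>odd q\<close> by blast
qed

text \<open>For the least return length \<open>l\<close>, every closed walk of that length has
  weight -1. If \<open>l < m\<close>, all diagonal entries of the \<open>l\<close>-th polynomial are
  at most 0 and one is negative, against trace 0.\<close>

lemma no_early_return:
  assumes "returns k"
  shows "m \<le> k"
proof (rule ccontr)
  assume "\<not> m \<le> k"
  define l where "l = (LEAST k. returns k)"
  have l: "returns l" "l \<le> k" using assms by (auto simp: l_def intro: LeastI Least_le)
  have least: "\<not> returns j" if "j < l" for j using that not_less_Least by (simp add: l_def)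
  have lm: "0 < l" "l < m" using l \<open>\<not> m \<le> k\<close> by (auto simp: returns_def)
  have arr: "arrival v w l v = (if walk v w l = v then -1 else 0)" if "v < m" "w \<in> nb v" for v w
    using first_return[OF lm(1) least that] by (auto simp: arrival_def)
  obtain a b where ab: "a < m" "b \<in> nb a" "walk a b l = a" using l(1) by (auto simp: returns_def)
  have "(\<Sum>v<m. Re (lucas m h l v v)) < (\<Sum>v<m. 0)"
  proof (rule sum_strict_mono_ex1)
    show "\<forall>v\<in>{..<m}. Re (lucas m h l v v) \<le> 0"
    proof
      fix v assume v: "v \<in> {..<m}"
      then obtain w where w: "w \<in> nb v" using degree_eq_2[of v] by fastforce
      show "Re (lucas m h l v v) \<le> 0"
        using lucas_eq_arrival[of v w v l] arr[of v w] arr[of v "other w v"] v w other_mem[of v w] by auto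
    qed
    have "Re (lucas m h l a a) < 0"
      using lucas_eq_arrival[OF ab(1,2,1), of l] arr[OF ab(1,2)] arr[OF ab(1) other_mem[OF ab(1,2)]] ab(3)
      by auto
    then show "\<exists>v\<in>{..<m}. Re (lucas m h l v v) < 0" using ab(1) by blast
  qed simp
  moreover have "(\<Sum>v<m. Re (lucas m h l v v)) = 0"
    using arg_cong[OF trace_less[OF lm], of Re] by simp
  ultimately show False by simp
qed

text \<open>Without early returns the walk from vertex 0 is injective on its first \<open>m\<close>
  steps, so it runs through all vertices.\<close>

lemma signed_cycle:
  obtains s a where "bij_betw s {..<m} {..<m}" "\<And>i. i < m \<Longrightarrow> a i \<in> {1, -1, \<i>, -\<i>}"
    "\<And>i j. i < m \<Longrightarrow> j < m \<Longrightarrow> h (s i) (s j) =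
       (if j = Suc i mod m \<or> i = Suc j mod m then - cnj (a i) * a j else 0)"
proof -
  have m0: "0 < m" using m3 by simp
  then obtain b where b: "b \<in> nb 0" using degree_eq_2[of 0] by fastforce
  define s where "s = walk 0 b"
  \<comment> \<open>The sign makes each step of the walk contribute
    \<open>- cnj (a i) * a (Suc i)\<close>. It also closes up:
    \<open>a m = (-1)^m * (-1) = 1 = a 0\<close> because \<open>m\<close> is odd.\<close>
  define a where "a i = (-1) ^ i * weight 0 b i" for i
  have sm: "s i < m" "s (Suc i) \<in> nb (s i)" for i using walk_step[OF m0 b] by (auto simp: s_def)
  have inj: "inj_on s {..<m}"
  proof (rule linorder_inj_onI)
    fix i j assume ij: "i < j" "i \<in> {..<m}" "j \<in> {..<m}"
    show "s i \<noteq> s j"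
    proof
      assume "s i = s j"
      then have "walk (s i) (s (Suc i)) (j - i) = s i"
        using walk_add[of 0 b i "j - i"] ij by (simp add: s_def)
      then have "returns (j - i)" using sm[of i] ij unfolding returns_def by auto
      then show False using no_early_return ij by fastforce
    qed
  qed auto
  then have bij: "bij_betw s {..<m} {..<m}"
    using sm by (intro bij_betw_imageI endo_inj_surj) auto
  have au: "a i \<in> {1, -1, \<i>, -\<i>}" for i
    using weight_mem[OF m0 b, of i] by (cases "even i") (auto simp: a_def)
  have "cnj (a i) * a i = 1" for i using au[of i] by auto
  moreover have "a (Suc i) = - a i * h (s i) (s (Suc i))" for i
    using weight_add[of 0 b i 1] by (simp add: a_def s_def)
  ultimately have "h (s i) (s (Suc i)) = - cnj (a i) * a (Suc i)" for i
    by (metis minus_mult_minus mult.assoc mult_1 mult_minus_left)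
  moreover have "s m = s 0" "a m = a 0"
    using walk_m[OF m0 b] odd_m by (auto simp: s_def a_def)
  then have wrap: "s (Suc i mod m) = s (Suc i) \<and> a (Suc i mod m) = a (Suc i)" if "i < m" for i
    using that by (cases "Suc i = m") auto
  ultimately have fwd: "h (s i) (s (Suc i mod m)) = - cnj (a i) * a (Suc i mod m)" if "i < m" for i
    using that by simp
  have fwd_nb: "s (Suc i mod m) \<in> nb (s i)" if "i < m" for i
    using that wrap sm(2) by simp
  have eq: "h (s i) (s j) = (if j = Suc i mod m \<or> i = Suc j mod m then - cnj (a i) * a j else 0)"
    if ij: "i < m" "j < m" for i j
  proof -
    consider "j = Suc i mod m" | "i = Suc j mod m" | "j \<noteq> Suc i mod m" "i \<noteq> Suc j mod m" by blast
    then show ?thesis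
    proof cases
      case 1
      then show ?thesis using fwd[OF ij(1)] by simp
    next
      case 2
      then show ?thesis using fwd[OF ij(2)] herm[of "s j" "s i"] sm(1) by simp
    next
      case 3
      \<comment> \<open>The predecessor of \<open>i\<close>. By 2-regularity \<open>s p\<close> and
        the successor exhaust the neighbours of \<open>s i\<close>, so all other entries
        vanish.\<close>
      define p where "p = (i + (m - 1)) mod m"
      have p: "p < m" "Suc p mod m = i" using ij m0 by (auto simp: p_def mod_Suc_eq)
      have "s p \<in> nb (s i)" using fwd_nb[OF p(1)] p(2) nb_sym sm(1) by simp
      moreover have "s p \<noteq> s (Suc i mod m)"
        using inj Suc_mod_neq[OF m3 ij(1) p(2,1)] p(1) m0 by (auto simp: inj_on_def)
      ultimately have "nb (s i) = {s p, s (Suc i mod m)}"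
        using fwd_nb[OF ij(1)] nb_eq_other(1)[OF sm(1)] other_eq[OF sm(1)] by metis
      moreover have "j \<noteq> p" using 3 p(2) by auto
      then have "s j \<notin> {s p, s (Suc i mod m)}"
        using inj 3(1) ij p(1) m0 by (auto simp: inj_on_def)
      ultimately show ?thesis using 3 sm(1)[of j] by (auto simp: nb_def)
    qed
  qed
  show thesis using that[OF bij au eq] .
qed

end

subsection \<open>Mixed graphs\<close>

lemma lucas_signed_cycle_traces:
  fixes h :: "nat \<Rightarrow> nat \<Rightarrow> complex"
  assumes m: "m \<ge> 3" "odd m"
    and h: "\<And>u v. u < m \<Longrightarrow> v < m \<Longrightarrow>
      h u v = (if v = Suc u mod m \<or> u = Suc v mod m then - cnj (a u) * a v else 0)"
    and a: "\<And>u. u < m \<Longrightarrow> cnj (a u) * a u = 1"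
  shows "0 < k \<Longrightarrow> k < m \<Longrightarrow> (\<Sum>u<m. lucas m h k u u) = 0"
    and "(\<Sum>u<m. lucas m h m u u) = - (2 * of_nat m)"
    and "(\<Sum>u<m. \<Sum>v<m. lucas m h m u v * lucas m h m v u) = 4 * of_nat m"
    and "(\<Sum>u<m. \<Sum>v<m. lucas m h 2 u v * lucas m h 2 v u) = 2 * of_nat m"
proof -
  have L: "lucas m h k u v = (-1) ^ k * cnj (a u) * a v *
    ((if v = (u + k) mod m then 1 else 0) + (if u = (v + k) mod m then 1 else 0))"
    if "u < m" "v < m" for k u v
    using m(1) h a that by (rule lucas_signed_cycle)
  {
    assume k: "0 < k" "k < m"
    have "u \<noteq> (u + k) mod m" if "u < m" for u
      using k that by (cases "u + k < m") (auto simp: mod_if)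
    then show "(\<Sum>u<m. lucas m h k u u) = 0" by (simp add: L)
  }
  have Lm: "lucas m h m u v = (if u = v then -2 else 0)" if "u < m" "v < m" for u v
    using that a[OF that(1)] m(2) by (auto simp: L mult.assoc)
  show "(\<Sum>u<m. lucas m h m u u) = - (2 * of_nat m)" by (simp add: Lm)
  have "(\<Sum>u<m. \<Sum>v<m. lucas m h m u v * lucas m h m v u) = (\<Sum>u<m. \<Sum>v<m. if u = v then 4 else 0)"
    by (intro sum.cong refl) (simp add: Lm)
  then show "(\<Sum>u<m. \<Sum>v<m. lucas m h m u v * lucas m h m v u) = 4 * of_nat m" by simp
  have "lucas m h 2 u v * lucas m h 2 v u = (if v = (u + 2) mod m then 1 else 0) + (if u = (v + 2) mod m then 1 else 0)"
    if uv: "u < m" "v < m" for u v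
  proof -
    have "(x + 2) mod m = (if x + 2 < m then x + 2 else x + 2 - m)" if "x < m" for x
      using that m(1) by (simp add: mod_if)
    \<comment> \<open>For \<open>m = 4\<close> the vertices two steps ahead and two steps behind
      would coincide and the indicators would add up before squaring.\<close>
    moreover have "m \<noteq> 4" using m(2) by auto
    ultimately have neq: "\<not> (v = (u + 2) mod m \<and> u = (v + 2) mod m)"
      using uv m(1) by (auto split: if_splits)
    have "cnj (a u) * a v * (cnj (a v) * a u) = (cnj (a u) * a u) * (cnj (a v) * a v)"
      by (simp add: mult_ac)
    then have one: "cnj (a u) * a v * (cnj (a v) * a u) = 1"
      unfolding a[OF uv(1)] a[OF uv(2)] by simp
    have regroup: "((-1)\<^sup>2 * p * q * x) * ((-1)\<^sup>2 * r * s * y) = p * q * (r * s) * (x * y)"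
      for p q r s x y :: complex by (simp add: mult_ac)
    show ?thesis unfolding L[OF uv] L[OF uv(2,1)] regroup one using neq by auto
  qed
  then have "(\<Sum>u<m. \<Sum>v<m. lucas m h 2 u v * lucas m h 2 v u)
      = (\<Sum>u<m. \<Sum>v<m. if v = (u + 2) mod m then 1 else 0) + (\<Sum>u<m. \<Sum>v<m. if u = (v + 2) mod m then 1 else 0)"
    by (simp add: sum.distrib)
  also have "(\<Sum>u<m. \<Sum>v<m. if u = (v + 2) mod m then 1 else 0)
      = (\<Sum>v<m. \<Sum>u<m. if u = (v + 2) mod m then 1 else (0::complex))"
    by (rule sum.swap)
  finally show "(\<Sum>u<m. \<Sum>v<m. lucas m h 2 u v * lucas m h 2 v u) = 2 * of_nat m"
    using m by simp
qed

lemma cospectral_matrixI: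
  fixes g h :: "nat \<Rightarrow> nat \<Rightarrow> complex"
  assumes m: "m \<ge> 3" "odd m"
    and g: "\<And>u v. u < m \<Longrightarrow> v < m \<Longrightarrow>
      g u v = (if v = Suc u mod m \<or> u = Suc v mod m then - cnj (a u) * a v else 0)"
    and a: "\<And>u. u < m \<Longrightarrow> cnj (a u) * a u = 1"
    and char: "char_poly (mat m m (\<lambda>(i, j). h i j)) = char_poly (mat m m (\<lambda>(i, j). g i j))"
    and h: "\<And>u v. u < m \<Longrightarrow> v < m \<Longrightarrow> h v u = cnj (h u v)"
      "\<And>u. u < m \<Longrightarrow> h u u = 0"
      "\<And>u v. u < m \<Longrightarrow> v < m \<Longrightarrow> h u v \<in> {0, 1, -1, \<i>, -\<i>}"
  shows "cospectral_matrix m h"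
  unfolding cospectral_matrix_def lucas_trace_eq[OF char]
  using m lucas_signed_cycle_traces[OF m g a] h by blast

lemma hentry_cnj:
  assumes "mixed_graph X"
  shows "hentry X v u = cnj (hentry X u v)"
  using assms by (fastforce simp: hentry_def mixed_graph_def insert_commute)

lemma hentry_self:
  assumes "mixed_graph X"
  shows "hentry X u u = 0"
proof -
  have "{u, u} \<notin> edges X"
  proof
    assume "{u, u} \<in> edges X"
    then obtain x y where "{u, u} = {x, y}" "x \<noteq> y" using assms unfolding mixed_graph_def by blast
    then show False by (metis doubleton_eq_iff)
  qed
  moreover have "(u, u) \<notin> arcs X" using assms by (auto simp: mixed_graph_def)
  ultimately show ?thesis by (simp add: hentry_def)
qed

lemma hentry_mem: "hentry X u v \<in> {0, 1, -1, \<i>, -\<i>}"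
  by (simp add: hentry_def)

text \<open>Solves \<open>- cnj (a i) * a (Suc i) = hentry\<close> along the cycle from
  \<open>a 0 = 1\<close>: the two arcs force \<open>- \<i>\<close> and -1, and the edges then
  alternate signs. The last edge back to 0 fits because \<open>m\<close> is odd.\<close>

definition cycle2_sign :: "nat \<Rightarrow> complex" where
  "cycle2_sign i = (if i = 0 then 1 else if i = 1 then - \<i> else (-1) ^ Suc i)"

lemma cycle2_sign_mem: "cycle2_sign i \<in> {1, -1, \<i>, -\<i>}"
  by (cases "even i") (auto simp: cycle2_sign_def)

lemma hentry_mixed_cycle2:
  assumes m: "m \<ge> 3" "odd m" and uv: "u < m" "v < m"
  shows "hentry (mixed_cycle2 m) u v
    = (if v = Suc u mod m \<or> u = Suc v mod m then - cnj (cycle2_sign u) * cycle2_sign v else 0)"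
proof -
  let ?X = "mixed_cycle2 m" and ?a = cycle2_sign
  have mg: "mixed_graph ?X" using m(1) by (rule mixed_graph_mixed_cycle2)
  have edge: "{u, v} \<in> edges ?X \<longleftrightarrow> 2 \<le> u \<and> v = Suc u mod m \<or> 2 \<le> v \<and> u = Suc v mod m"
    if "u < m" "v < m" for u v
    using that by (auto simp: mixed_cycle2_def doubleton_eq_iff)
  have arc: "(u, v) \<in> arcs ?X \<longleftrightarrow> u < 2 \<and> v = Suc u mod m" if "u < m" for u v
    using that m(1) by (auto simp: mixed_cycle2_def less_2_cases_iff)
  have fwd: "hentry ?X u (Suc u mod m) = - cnj (?a u) * ?a (Suc u mod m)" if u: "u < m" for u
  proof -
    have v: "Suc u mod m < m" using m by simp
    consider "u = 0" | "u = 1" | "2 \<le> u" "Suc u < m" | "2 \<le> u" "Suc u = m" using u by linarith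
    then show ?thesis
    proof cases
      case 1
      have "{0, Suc 0} \<notin> edges ?X" using edge[of 0 1] m(1) by simp
      moreover have "(0, Suc 0) \<in> arcs ?X" by (simp add: mixed_cycle2_def)
      ultimately show ?thesis using 1 m(1) by (simp add: hentry_def cycle2_sign_def)
    next
      case 2
      have "3 mod m \<noteq> Suc 0" using m(1) by (cases "m = 3") auto
      then have "{Suc 0, 2} \<notin> edges ?X" using edge[of 1 2] m(1) by auto
      moreover have "(Suc 0, 2) \<in> arcs ?X" by (simp add: mixed_cycle2_def)
      moreover have "Suc u mod m = 2" using 2 m(1) by simp
      ultimately show ?thesis using 2 by (simp add: hentry_def cycle2_sign_def)
    next
      case 3
      then have "hentry ?X u (Suc u mod m) = 1" using edge[OF u v] by (simp add: hentry_def)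
      moreover have "((-1) ^ u * (-1) ^ u :: complex) = 1" by (simp flip: power_mult_distrib)
      ultimately show ?thesis using 3 by (simp add: cycle2_sign_def)
    next
      case 4
      then have "hentry ?X u (Suc u mod m) = 1" using edge[OF u v] by (simp add: hentry_def)
      moreover have "even u" using 4 m(2) by auto
      ultimately show ?thesis using 4 m(2) by (simp add: cycle2_sign_def)
    qed
  qed
  consider "v = Suc u mod m" | "u = Suc v mod m" | "v \<noteq> Suc u mod m" "u \<noteq> Suc v mod m" by blast
  then show ?thesis
  proof cases
    case 1
    then show ?thesis using fwd[OF uv(1)] by simp
  next
    case 2
    then show ?thesis using fwd[OF uv(2)] hentry_cnj[OF mg, of u v] by simp
  next
    case 3
    then show ?thesis using edge[OF uv] arc uv by (simp add: hentry_def)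
  qed
qed

text \<open>Used to place a copy of the cycle on the vertices of the competing graph.\<close>

definition map_graph :: "('a \<Rightarrow> 'b) \<Rightarrow> 'a mixed_graph \<Rightarrow> 'b mixed_graph" where
  "map_graph f X =
     \<lparr>verts = f ` verts X, edges = (`) f ` edges X, arcs = map_prod f f ` arcs X\<rparr>"

lemma map_graph:
  assumes X: "mixed_graph X" and f: "inj_on f (verts X)"
  shows edges_map_graph: "\<And>u v. u \<in> verts X \<Longrightarrow> v \<in> verts X \<Longrightarrow>
      {f u, f v} \<in> edges (map_graph f X) \<longleftrightarrow> {u, v} \<in> edges X"
    and arcs_map_graph: "\<And>u v. u \<in> verts X \<Longrightarrow> v \<in> verts X \<Longrightarrow>
      (f u, f v) \<in> arcs (map_graph f X) \<longleftrightarrow> (u, v) \<in> arcs X"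
    and mixed_graph_map_graph: "mixed_graph (map_graph f X)"
    and isomorphic_map_graph: "isomorphic (map_graph f X) X"
proof -
  let ?Z = "map_graph f X"
  have sub: "e \<subseteq> verts X" if "e \<in> edges X" for e
    using X that unfolding mixed_graph_def by blast
  show E: "{f u, f v} \<in> edges ?Z \<longleftrightarrow> {u, v} \<in> edges X" if "u \<in> verts X" "v \<in> verts X" for u v
  proof
    assume "{f u, f v} \<in> edges ?Z"
    then obtain e where e: "e \<in> edges X" "f ` {u, v} = f ` e" by (auto simp: map_graph_def)
    then have "{u, v} = e" using inj_on_image_eq_iff[OF f, of "{u, v}" e] sub that by blast
    then show "{u, v} \<in> edges X" using e by simp
  next
    assume "{u, v} \<in> edges X"
    then have "f ` {u, v} \<in> (`) f ` edges X" by (rule imageI)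
    then show "{f u, f v} \<in> edges ?Z" by (simp add: map_graph_def)
  qed
  have asub: "u \<in> verts X \<and> v \<in> verts X \<and> u \<noteq> v" if "(u, v) \<in> arcs X" for u v
    using X that by (auto simp: mixed_graph_def)
  show A: "(f u, f v) \<in> arcs ?Z \<longleftrightarrow> (u, v) \<in> arcs X" if "u \<in> verts X" "v \<in> verts X" for u v
  proof
    assume "(f u, f v) \<in> arcs ?Z"
    then obtain x y where xy: "(x, y) \<in> arcs X" "f u = f x" "f v = f y" by (auto simp: map_graph_def)
    then have "u = x" "v = y" using asub[OF xy(1)] that by (auto intro: inj_onD[OF f])
    then show "(u, v) \<in> arcs X" using xy(1) by simp
  next
    assume "(u, v) \<in> arcs X"
    then have "map_prod f f (u, v) \<in> map_prod f f ` arcs X" by (rule imageI)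
    then show "(f u, f v) \<in> arcs ?Z" by (simp add: map_graph_def)
  qed
  show "mixed_graph ?Z"
    unfolding mixed_graph_def
  proof (intro conjI)
    show "finite (verts ?Z)" using X by (simp add: map_graph_def mixed_graph_def)
    show "edges ?Z \<subseteq> {{u, v} |u v. u \<in> verts ?Z \<and> v \<in> verts ?Z \<and> u \<noteq> v}"
    proof
      fix e assume "e \<in> edges ?Z"
      then obtain e' where "e' \<in> edges X" "e = f ` e'" by (auto simp: map_graph_def)
      moreover from this(1) obtain u v where "e' = {u, v}" "u \<in> verts X" "v \<in> verts X" "u \<noteq> v"
        using X unfolding mixed_graph_def by blast
      ultimately have "e = {f u, f v}" "f u \<in> verts ?Z" "f v \<in> verts ?Z" "f u \<noteq> f v"
        using f by (auto simp: map_graph_def inj_on_def)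
      then show "e \<in> {{u, v} |u v. u \<in> verts ?Z \<and> v \<in> verts ?Z \<and> u \<noteq> v}" by blast
    qed
    show "arcs ?Z \<subseteq> {(u, v). u \<in> verts ?Z \<and> v \<in> verts ?Z \<and> u \<noteq> v}"
    proof (rule subrelI)
      fix x y assume "(x, y) \<in> arcs ?Z"
      then obtain u v where "(u, v) \<in> arcs X" "x = f u" "y = f v" by (auto simp: map_graph_def)
      then show "(x, y) \<in> {(u, v). u \<in> verts ?Z \<and> v \<in> verts ?Z \<and> u \<noteq> v}"
        using asub[of u v] inj_onD[OF f, of u v] by (auto simp: map_graph_def)
    qed
    show "\<forall>(x, y) \<in> arcs ?Z. (y, x) \<notin> arcs ?Z \<and> {x, y} \<notin> edges ?Z"
    proof (intro ballI, clarify)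
      fix x y assume "(x, y) \<in> arcs ?Z"
      then obtain u v where uv: "(u, v) \<in> arcs X" "x = f u" "y = f v" by (auto simp: map_graph_def)
      then have "(v, u) \<notin> arcs X" "{u, v} \<notin> edges X" using X by (auto simp: mixed_graph_def)
      then show "(y, x) \<notin> arcs ?Z \<and> {x, y} \<notin> edges ?Z" using uv asub A E by simp
    qed
  qed
  show "isomorphic ?Z X"
    unfolding isomorphic_def
  proof (intro exI conjI ballI)
    let ?g = "the_inv_into (verts X) f"
    show "bij_betw ?g (verts ?Z) (verts X)"
      using f by (intro bij_betw_the_inv_into) (simp add: map_graph_def bij_betw_def)
    fix x y assume "x \<in> verts ?Z" "y \<in> verts ?Z"
    then obtain u v where "u \<in> verts X" "x = f u" "v \<in> verts X" "y = f v" by (auto simp: map_graph_def)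
    then show "{x, y} \<in> edges ?Z \<longleftrightarrow> {?g x, ?g y} \<in> edges X"
      "(x, y) \<in> arcs ?Z \<longleftrightarrow> (?g x, ?g y) \<in> arcs X"
      using E A by (simp_all add: the_inv_into_f_f[OF f])
  qed
qed

text \<open>A monic complex polynomial is determined by its multiset of roots, and the degree of a
  characteristic polynomial is the size of the matrix; so the competing graph has equally many
  vertices.\<close>

lemma char_poly_eq_of_proots_eq:
  fixes A B :: "complex mat"
  assumes "A \<in> carrier_mat n n" "B \<in> carrier_mat k k"
    and "proots (char_poly A) = proots (char_poly B)"
  shows "char_poly A = char_poly B" "n = k"
proof -
  have "lead_coeff (char_poly A) = 1" "lead_coeff (char_poly B) = 1"
    using degree_monic_char_poly assms(1,2) by auto
  then show eq: "char_poly A = char_poly B"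
    using complex_poly_decompose_multiset[of "char_poly A"]
      complex_poly_decompose_multiset[of "char_poly B"] assms(3) by simp
  show "n = k" using degree_monic_char_poly assms(1,2) eq by metis
qed

theorem theorem4p7:
  fixes n :: nat
  assumes "n \<ge> 1"
  shows "DHS TYPE('b) (mixed_cycle2 (2 * n + 1))"
  unfolding DHS_def
proof (intro allI impI, elim conjE)
  fix Y :: "'b mixed_graph"
  define m where "m = 2 * n + 1"
  let ?X = "mixed_cycle2 m"
  assume Y: "mixed_graph Y" and "spec_H Y = spec_H (mixed_cycle2 (2 * n + 1))"
  then have spec: "spec_H Y = spec_H ?X" by (simp add: m_def)
  have m: "m \<ge> 3" "odd m" using assms by (auto simp: m_def)
  have X: "mixed_graph ?X" using m(1) by (rule mixed_graph_mixed_cycle2)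
  have Xv: "verts ?X = {..<m}" by (auto simp: mixed_cycle2_def)
  define a where "a = cycle2_sign"
  have au: "a i \<in> {1, -1, \<i>, -\<i>}" for i unfolding a_def by (rule cycle2_sign_mem)
  have a1: "cnj (a i) * a i = 1" if "i < m" for i using au[of i] by auto
  note g = hentry_mixed_cycle2[OF m, folded a_def]
  define vs where "vs = enum_of (verts Y)"
  have fin: "finite (verts Y)" using Y by (simp add: mixed_graph_def)
  note vs = enum_of(1,2)[OF fin, folded vs_def]
  define h where "h i j = hentry Y (vs ! i) (vs ! j)" for i j
  have HX: "hmat ?X [0..<m] = mat m m (\<lambda>(i, j). hentry ?X i j)"
    by (auto simp: hmat_def intro!: eq_matI)
  have HY: "hmat Y vs = mat (length vs) (length vs) (\<lambda>(i, j). h i j)"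
    by (simp add: hmat_def h_def)
  have "proots (char_poly (hmat Y vs)) = proots (char_poly (hmat ?X [0..<m]))"
    using spec spec_H_eq[of vs Y] spec_H_eq[of "[0..<m]" ?X] vs Xv by (simp add: atLeast0LessThan)
  from char_poly_eq_of_proots_eq[OF hmat_dim hmat_dim this]
  have char: "char_poly (hmat Y vs) = char_poly (hmat ?X [0..<m])" and len: "length vs = m"
    by auto
  have "cospectral_matrix m h"
  proof (rule cospectral_matrixI[OF m, of "hentry ?X" a])
    show "char_poly (mat m m (\<lambda>(i, j). h i j)) = char_poly (mat m m (\<lambda>(i, j). hentry ?X i j))"
      using char unfolding HX HY len .
  qed (unfold h_def, fact g, fact a1, rule hentry_cnj[OF Y], rule hentry_self[OF Y], rule hentry_mem)
  then interpret cospectral_matrix m h .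
  obtain s b where s: "bij_betw s {..<m} {..<m}" and bu: "\<And>i. i < m \<Longrightarrow> b i \<in> {1, -1, \<i>, -\<i>}"
    and hs: "\<And>i j. i < m \<Longrightarrow> j < m \<Longrightarrow> h (s i) (s j) =
       (if j = Suc i mod m \<or> i = Suc j mod m then - cnj (b i) * b j else 0)"
    using signed_cycle by blast
  \<comment> \<open>Sends a vertex of \<open>mixed_cycle2 m\<close> to the vertex of
    \<open>Y\<close> at the same place along the cycle found by \<open>signed_cycle\<close>.\<close>
  define f where "f i = vs ! s i" for i
  have "bij_betw ((!) vs) {..<m} (verts Y)" using bij_betw_nth[OF vs(1)] len vs(2) by auto
  from bij_betw_trans[OF s this] have f: "bij_betw f {..<m} (verts Y)"
    by (simp add: f_def[abs_def] comp_def)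
  then have inj: "inj_on f (verts ?X)" by (simp add: Xv bij_betw_def)
  define Z where "Z = map_graph f ?X"
  have Zv: "verts Z = verts Y" using f Xv by (simp add: Z_def map_graph_def bij_betw_def)
  have Zh: "hentry Z (f i) (f j) = hentry ?X i j" if "i < m" "j < m" for i j
    using that edges_map_graph[OF X inj, of i j] arcs_map_graph[OF X inj, of i j]
      arcs_map_graph[OF X inj, of j i] by (simp add: hentry_def Z_def Xv)
  \<comment> \<open>Both graphs switch to the cycle with all entries -1, through \<open>a\<close>
    and \<open>b\<close>; the required switching is the quotient, with \<open>cnj (a i)\<close> as
    the inverse of \<open>a i\<close>.\<close>
  define d where "d v = (let i = the_inv_into {..<m} f v in cnj (a i) * b i)" for v
  have df: "d (f i) = cnj (a i) * b i" if "i < m" for i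
    using that f by (simp add: d_def the_inv_into_f_f bij_betw_def)
  have du: "d (f i) \<in> {1, -1, \<i>, -\<i>}" if "i < m" for i
    using au[of i] bu[OF that] unfolding df[OF that] by auto
  have entry: "hentry Y (f i) (f j) = inverse (d (f i)) * hentry Z (f i) (f j) * d (f j)"
    if ij: "i < m" "j < m" for i j
  proof -
    have "inverse (d (f i)) = a i * cnj (b i)"
      using au[of i] bu[OF ij(1)] unfolding df[OF ij(1)] by auto
    then have "inverse (d (f i)) * hentry Z (f i) (f j) * d (f j)
        = (if j = Suc i mod m \<or> i = Suc j mod m
           then - cnj (b i) * b j * (cnj (a i) * a i) * (cnj (a j) * a j) else 0)"
      unfolding Zh[OF ij] g[OF ij] df[OF ij(2)] by simp
    also have "\<dots> = h (s i) (s j)" unfolding a1[OF ij(1)] a1[OF ij(2)] hs[OF ij] by simp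
    finally show ?thesis by (simp add: h_def f_def)
  qed
  have im: "verts Y = f ` {..<m}" using f by (simp add: bij_betw_def)
  have "switching_equivalent Y Z"
    unfolding switching_equivalent_iff[OF fin] Zv using du entry
    by (intro conjI exI[of _ d]) (auto simp only: im)
  then show "\<exists>Z :: 'b mixed_graph. mixed_graph Z \<and> isomorphic Z (mixed_cycle2 (2 * n + 1)) \<and> switching_equivalent Y Z"
    using mixed_graph_map_graph[OF X inj] isomorphic_map_graph[OF X inj]
    unfolding Z_def m_def by blast
qed

end
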